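(* Let $M>-\frac14$, $w>0$ and $v=\frac1{1+w^2}$. The quotient between the maximum value of the Gauss curvature and the minimum value of the Gauss curvature of the Twizzler $\mathfrak{T}(M,v)$ is $$-\frac{2+(1+2M-\sqrt{1+4M})\,w^2}{2+(1+2M+\sqrt{1+4M})\,w^2}.$$ Moreover, for any fixed $c\in(0,1)$, all the Twizzlers in the set $$\left\{\mathfrak{T}\Big(M,\tfrac{\sqrt{1+4M}-1-2M+c(\sqrt{1+4M}+1+2M)}{\sqrt{1+4M}+1-2M+c(\sqrt{1+4M}-1+2M)}\Big)\ :\ M\in\Big(-\tfrac{\sqrt c}{(1+\sqrt c)^2},\tfrac{\sqrt c}{(1-\sqrt c)^2}\Big)\right\}$$ are isometric to each other.
   Context: Twizzlers: a Twizzler is an immersion $\phi(s,t)=(x(s)\cos(wt)+z(s)\sin(wt),\,t,\,-x(s)\sin(wt)+z(s)\cos(wt))$, $(s,t)\in\mathbb{R}^2$, of constant mean curvature; $\alpha(s)=(x(s),z(s))$, $s\in\mathbb{R}$, parametrized by arc length, is its profile curve. The mean curvature (half the sum of the principal curvatures) is taken with respect to $\nu=\frac{\phi_s\times\phi_t}{|\phi_s\times\phi_t|}$. Put $\xi_1=xx'+zz'$, $\xi_2=-xz'+zx'$. $\mathfrak{T}(M,v)$, for $M>-\frac14$ and $0<v<1$, denotes the Twizzler (unique up to rigid motions) with mean curvature $1$ and parameter $w=\sqrt{(1-v)/v}$ for which $s\mapsto(\xi_1(s),\xi_2(s))$ traverses the closed curve $h_w^{-1}(M)$, where $h_w(x_1,x_2)=x_1^2+x_2^2+\frac{x_2}{\sqrt{1+w^2x_1^2}}$;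 that is, $h_w(\xi_1(s),\xi_2(s))=M$ for all $s$. Two Twizzlers are isometric if $\mathbb{R}^2$ with the metrics induced by the two immersions are isometric Riemannian surfaces. *)

theory Defs
  imports "HOL-Analysis.Analysis"
begin

section \<open>Smooth maps and immersions\<close>

primrec C_k :: "nat \<Rightarrow> ('a::real_normed_vector \<Rightarrow> 'b::real_normed_vector) \<Rightarrow> bool" where
  "C_k 0 f \<longleftrightarrow> continuous_on UNIV f"
| "C_k (Suc n) f \<longleftrightarrow> (\<forall>p. f differentiable (at p)) \<and>
     (\<forall>v. C_k n (\<lambda>p. frechet_derivative f (at p) v))"

definition smooth :: "('a::real_normed_vector \<Rightarrow> 'b::real_normed_vector) \<Rightarrow> bool" where
  "smooth f \<longleftrightarrow> (\<forall>n. C_k n f)"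

definition immersion :: "('a::real_normed_vector \<Rightarrow> 'b::real_normed_vector) \<Rightarrow> bool" where
  "immersion f \<longleftrightarrow> smooth f \<and> (\<forall>p. inj (frechet_derivative f (at p)))"

section \<open>Parametrized surfaces in Euclidean space\<close>

type_synonym surface = "real \<times> real \<Rightarrow> real ^ 3"

definition unit_normal :: "surface \<Rightarrow> real \<times> real \<Rightarrow> real ^ 3" where
  "unit_normal \<phi> p =
     (let n = cross3 (frechet_derivative \<phi> (at p) (1, 0)) (frechet_derivative \<phi> (at p) (0, 1))
      in n /\<^sub>R norm n)"

definition induced_metric :: "surface \<Rightarrow> real \<times> real \<Rightarrow> real \<times> real \<Rightarrow> real \<times> real \<Rightarrow> real" where
  "induced_metric \<phi> p u v = frechet_derivative \<phi> (at p) u \<bullet> frechet_derivative \<phi> (at p) v"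

definition second_fundamental_form ::
  "surface \<Rightarrow> real \<times> real \<Rightarrow> real \<times> real \<Rightarrow> real \<times> real \<Rightarrow> real" where
  "second_fundamental_form \<phi> p u v =
     frechet_derivative (\<lambda>q. frechet_derivative \<phi> (at q) v) (at p) u \<bullet> unit_normal \<phi> p"

text \<open>The principal curvatures are the eigenvalues of the shape operator \<open>S\<close>, which is given by
  \<open>I(S u, v) = II(u, v)\<close>; thus \<open>S u = k u\<close> says that \<open>II(u, v) = k I(u, v)\<close> for every \<open>v\<close>.\<close>

definition principal_curvatures :: "surface \<Rightarrow> real \<times> real \<Rightarrow> real set" where
  "principal_curvatures \<phi> p =
     {k. \<exists>u. u \<noteq> 0 \<and> (\<forall>v. second_fundamental_form \<phi> p u v = k * induced_metric \<phi> p u v)}"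

text \<open>For an immersion \<open>S\<close> is self-adjoint on a plane, so this set has two elements, or one
  if \<open>p\<close> is umbilic; \<open>Min\<close> and \<open>Max\<close> are then the two eigenvalues counted with multiplicity.\<close>

definition mean_curvature :: "surface \<Rightarrow> real \<times> real \<Rightarrow> real" where
  "mean_curvature \<phi> p = (Min (principal_curvatures \<phi> p) + Max (principal_curvatures \<phi> p)) / 2"

definition gauss_curvature :: "surface \<Rightarrow> real \<times> real \<Rightarrow> real" where
  "gauss_curvature \<phi> p = Min (principal_curvatures \<phi> p) * Max (principal_curvatures \<phi> p)"

text \<open>Isometry of the plane with the metric \<open>g\<close> and the plane with the metric \<open>g'\<close>: a
  diffeomorphism which pulls \<open>g'\<close> back to \<open>g\<close>.\<close>

definition isometric ::
  "(real \<times> real \<Rightarrow> real \<times> real \<Rightarrow> real \<times> real \<Rightarrow> real) \<Rightarrow>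
   (real \<times> real \<Rightarrow> real \<times> real \<Rightarrow> real \<times> real \<Rightarrow> real) \<Rightarrow> bool" where
  "isometric g g' \<longleftrightarrow>
     (\<exists>F. bij F \<and> smooth F \<and> smooth (inv F) \<and>
        (\<forall>p u v. g' (F p) (frechet_derivative F (at p) u) (frechet_derivative F (at p) v) = g p u v))"

section \<open>Twizzlers\<close>

definition twizzler_map :: "real \<Rightarrow> (real \<Rightarrow> real) \<Rightarrow> (real \<Rightarrow> real) \<Rightarrow> surface" where
  "twizzler_map w x z = (\<lambda>(s, t). vector
     [x s * cos (w * t) + z s * sin (w * t),
      t,
      - x s * sin (w * t) + z s * cos (w * t)])"

definition arc_length_parametrized :: "(real \<Rightarrow> real) \<Rightarrow> (real \<Rightarrow> real) \<Rightarrow> bool" where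
  "arc_length_parametrized x z \<longleftrightarrow> (\<forall>s. (deriv x s)\<^sup>2 + (deriv z s)\<^sup>2 = 1)"

definition twizzler :: "real \<Rightarrow> (real \<Rightarrow> real) \<Rightarrow> (real \<Rightarrow> real) \<Rightarrow> real \<Rightarrow> bool" where
  "twizzler w x z H \<longleftrightarrow> arc_length_parametrized x z \<and> immersion (twizzler_map w x z) \<and>
     (\<forall>p. mean_curvature (twizzler_map w x z) p = H)"

definition \<xi>\<^sub>1 :: "(real \<Rightarrow> real) \<Rightarrow> (real \<Rightarrow> real) \<Rightarrow> real \<Rightarrow> real" where
  "\<xi>\<^sub>1 x z s = x s * deriv x s + z s * deriv z s"

definition \<xi>\<^sub>2 :: "(real \<Rightarrow> real) \<Rightarrow> (real \<Rightarrow> real) \<Rightarrow> real \<Rightarrow> real" where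
  "\<xi>\<^sub>2 x z s = - x s * deriv z s + z s * deriv x s"

definition twizzler_h :: "real \<Rightarrow> real \<Rightarrow> real \<Rightarrow> real" where
  "twizzler_h w x\<^sub>1 x\<^sub>2 = x\<^sub>1\<^sup>2 + x\<^sub>2\<^sup>2 + x\<^sub>2 / sqrt (1 + w\<^sup>2 * x\<^sub>1\<^sup>2)"

text \<open>The Twizzler with parameters \<open>M > - 1/4\<close> and \<open>0 < v < 1\<close> is unique only up to rigid motions;
  \<open>\<TT> M v\<close> is the set of all immersions of the above form which represent it.\<close>

definition Twizzlers :: "real \<Rightarrow> real \<Rightarrow> surface set" ("\<TT>") where
  "\<TT> M v = {twizzler_map w x z | w x z.
     w = sqrt ((1 - v) / v) \<and> twizzler w x z 1 \<and> (\<forall>s. twizzler_h w (\<xi>\<^sub>1 x z s) (\<xi>\<^sub>2 x z s) = M)}"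

end

theory Submission
  imports Defs
begin

text \<open>
  Let \<open>F = w \<xi>\<^sub>2\<close>, \<open>G = 1 + w^2 (x^2 + z^2)\<close> and \<open>D^2 = G - F^2 = 1 + w^2 \<xi>\<^sub>1^2\<close>. The induced metric is
  \<open>ds^2 + 2 F ds dt + G dt^2\<close>, and all geometric quantities depend on \<open>s\<close> only. Put \<open>u = \<xi>\<^sub>2 / D\<close>. Since
  \<open>\<xi>\<^sub>1^2 + \<xi>\<^sub>2^2 = x^2 + z^2\<close>, the equation \<open>h_w(\<xi>\<^sub>1, \<xi>\<^sub>2) = M\<close> says \<open>G = 1 + w^2 (M - u)\<close>, whereas
  \<open>G = D^2 (1 + w^2 u^2)\<close> by definition. The condition that the mean curvature is \<open>1\<close> determines the curvature of
  the profile curve. Eliminating it, together with \<open>D\<close> and \<open>u\<close>, gives the Gauss curvature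
  \<open>K = 1 - G_min G_max / G^2\<close> (lemma \<open>gauss_curvature_eq\<close>), with constants \<open>G_min < G_max\<close> depending on \<open>M\<close>
  and \<open>w\<close>.

  The metric becomes \<open>d\<sigma>^2 + G dT^2\<close> in the coordinates \<open>\<sigma>\<close>, \<open>T = t + \<tau>\<close> with \<open>\<sigma>' = D / sqrt G\<close> and
  \<open>\<tau>' = F / G\<close>. As a function of the height \<open>\<sigma>\<close>, the warping factor \<open>G\<close> is a harmonic oscillation:
  \<open>G = (G_max + G_min) / 2 + (G_max - G_min) / 2 * cos (2 \<sigma>)\<close>. Instead of the second order equation, the
  proof uses that \<open>G - (G_max + G_min) / 2\<close> and half of \<open>dG/d\<sigma>\<close> are the coordinates of a point rotating
  uniformly in \<open>\<sigma>\<close> (lemmas \<open>phase_circle\<close>, \<open>phase_derivatives\<close>, \<open>phase_of_rotating_pair\<close>). Since \<open>\<sigma>\<close> is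
  a diffeomorphism of the line (lemma \<open>straightening_exists\<close>), both claims can be read off.

  The function \<open>G\<close> takes its extreme values \<open>G_min\<close>, \<open>G_max\<close>, and \<open>K\<close> increases with \<open>G\<close>; so the
  extreme values of \<open>K\<close> are \<open>(G_max - G_min) / G_max\<close> and \<open>- (G_max - G_min) / G_min\<close>, with quotient
  \<open>- G_min / G_max\<close>. This is the stated expression.

  If \<open>G_min = c G_max\<close>, then \<open>G\<close> is a constant multiple of \<open>1 + c + (1 - c) cos (2 \<sigma>)\<close>, and rescaling \<open>T\<close>
  by a constant identifies the metrics of any two Twizzlers with the same \<open>c\<close> (lemmas
  \<open>isometric_warped_metrics\<close>, \<open>isometric_if_same_ratio\<close>). The parameter \<open>v\<close> of the family is the solution of
  \<open>G_min = c G_max\<close> with \<open>w^2 = (1 - v) / v\<close>, and the interval for \<open>M\<close> is where this \<open>w^2\<close> is positive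
  (lemma \<open>isometric_family_parameter\<close>).
\<close>

section \<open>Smooth maps\<close>

lemma C_k_SucI:
  assumes "\<And>p. (f has_derivative D p) (at p)" and "\<And>v. C_k n (\<lambda>p. D p v)"
  shows "C_k (Suc n) f"
proof -
  have "frechet_derivative f (at p) = D p" for p
    using frechet_derivative_at[OF assms(1)] by simp
  then show ?thesis
    using assms by (auto simp: differentiable_def)
qed

lemma C_k_SucD:
  assumes "C_k (Suc n) f"
  shows "(f has_derivative frechet_derivative f (at p)) (at p)"
    and "C_k n (\<lambda>p. frechet_derivative f (at p) v)"
  using assms by (auto simp: frechet_derivative_works)

lemma C_k_Suc_imp_C_k: "C_k (Suc n) f \<Longrightarrow> C_k n f"
proof (induction n arbitrary: f)
  case 0
  then show ?case
    by (auto intro!: differentiable_imp_continuous_on differentiable_at_imp_differentiable_on)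
next
  case (Suc n)
  then show ?case
    by (metis C_k.simps(2))
qed

lemma C_k_const: "C_k n (\<lambda>p. c)"
proof (induction n arbitrary: c)
  case (Suc n)
  then show ?case
    by (intro C_k_SucI[where D = "\<lambda>p v. 0"]) auto
qed auto

lemma C_k_bounded_linear:
  assumes "bounded_linear L"
  shows "C_k n L"
proof (cases n)
  case 0
  then show ?thesis
    using assms by (simp add: linear_continuous_on)
next
  case (Suc k)
  have "C_k (Suc k) L"
    by (rule C_k_SucI[OF bounded_linear_imp_has_derivative[OF assms] C_k_const])
  then show ?thesis
    by (simp only: Suc)
qed

text \<open>Precomposition with a linear map is kept apart from the general chain rule because the
  directional derivative of \<open>L \<circ> f \<circ> A\<close> in the direction \<open>v\<close> has the same form, with \<open>f\<close> replaced by its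
  derivative in the fixed direction \<open>A v\<close>; hence no sum over a basis is needed. It extracts the
  profile curve from the immersion.\<close>
lemma C_k_compose_bounded_linear:
  assumes "bounded_linear L" and "bounded_linear A"
  shows "C_k n f \<Longrightarrow> C_k n (\<lambda>s. L (f (A s)))"
proof (induction n arbitrary: f)
  case 0
  have "continuous_on UNIV (\<lambda>s. f (A s))"
    by (rule continuous_on_compose2[OF 0[simplified] linear_continuous_on[OF assms(2)]]) simp
  then show ?case
    using continuous_on_compose2[OF linear_continuous_on[OF assms(1), of UNIV]] by simp
next
  case (Suc n)
  show ?case
  proof (rule C_k_SucI)
    show "((\<lambda>s. L (f (A s))) has_derivative (\<lambda>v. L (frechet_derivative f (at (A p)) (A v)))) (at p)" for p
      by (rule bounded_linear.has_derivative[OF assms(1) has_derivative_compose[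
            OF bounded_linear_imp_has_derivative[OF assms(2)] C_k_SucD(1)[OF Suc.prems]]])
    show "C_k n (\<lambda>p. L (frechet_derivative f (at (A p)) (A v)))" for v
      using Suc.IH[OF C_k_SucD(2)[OF Suc.prems]] .
  qed
qed

lemma C_k_add:
  "C_k n f \<Longrightarrow> C_k n g \<Longrightarrow> C_k n (\<lambda>p. f p + g p)"
proof (induction n arbitrary: f g)
  case (Suc n)
  show ?case
  proof (rule C_k_SucI)
    show "((\<lambda>p. f p + g p) has_derivative (\<lambda>v. frechet_derivative f (at p) v + frechet_derivative g (at p) v)) (at p)" for p
      by (rule has_derivative_add[OF C_k_SucD(1)[OF Suc.prems(1)] C_k_SucD(1)[OF Suc.prems(2)]])
    show "C_k n (\<lambda>p. frechet_derivative f (at p) v + frechet_derivative g (at p) v)" for v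
      by (intro Suc.IH
        C_k_SucD(2)[OF Suc.prems(1)] C_k_SucD(2)[OF Suc.prems(2)])
  qed
qed (simp add: continuous_on_add)

lemma C_k_Pair:
  "C_k n f \<Longrightarrow> C_k n g \<Longrightarrow> C_k n (\<lambda>p. (f p, g p))"
proof (induction n arbitrary: f g)
  case (Suc n)
  show ?case
  proof (rule C_k_SucI)
    show "((\<lambda>p. (f p, g p)) has_derivative (\<lambda>v. (frechet_derivative f (at p) v, frechet_derivative g (at p) v))) (at p)" for p
      by (rule has_derivative_Pair[OF C_k_SucD(1)[OF Suc.prems(1)] C_k_SucD(1)[OF Suc.prems(2)]])
    show "C_k n (\<lambda>p. (frechet_derivative f (at p) v, frechet_derivative g (at p) v))" for v
      by (intro Suc.IH
        C_k_SucD(2)[OF Suc.prems(1)] C_k_SucD(2)[OF Suc.prems(2)])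
  qed
qed (simp add: continuous_on_Pair)

lemma C_k_mult:
  fixes f g :: "'a::real_normed_vector \<Rightarrow> real"
  shows "C_k n f \<Longrightarrow> C_k n g \<Longrightarrow> C_k n (\<lambda>p. f p * g p)"
proof (induction n arbitrary: f g)
  case (Suc n)
  show ?case
  proof (rule C_k_SucI)
    show "((\<lambda>p. f p * g p) has_derivative (\<lambda>v. f p * frechet_derivative g (at p) v + frechet_derivative f (at p) v * g p)) (at p)" for p
      by (rule has_derivative_mult[OF C_k_SucD(1)[OF Suc.prems(1)] C_k_SucD(1)[OF Suc.prems(2)]])
    show "C_k n (\<lambda>p. f p * frechet_derivative g (at p) v + frechet_derivative f (at p) v * g p)" for v
      by (intro C_k_add Suc.IH C_k_Suc_imp_C_k[OF Suc.prems(1)] C_k_Suc_imp_C_k[OF Suc.prems(2)]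
        C_k_SucD(2)[OF Suc.prems(1)] C_k_SucD(2)[OF Suc.prems(2)])
  qed
qed (simp add: continuous_on_mult)

lemma C_k_inverse:
  fixes f :: "'a::real_normed_vector \<Rightarrow> real"
  assumes "\<And>p. f p \<noteq> 0"
  shows "C_k n f \<Longrightarrow> C_k n (\<lambda>p. inverse (f p))"
proof (induction n)
  case 0
  then show ?case by (simp add: continuous_on_inverse assms)
next
  case (Suc n)
  have I: "C_k n (\<lambda>p. inverse (f p))"
    by (rule Suc.IH[OF C_k_Suc_imp_C_k[OF Suc.prems]])
  show ?case
  proof (rule C_k_SucI)
    show "((\<lambda>p. inverse (f p)) has_derivative
        (\<lambda>v. - 1 * (inverse (f p) * (frechet_derivative f (at p) v * inverse (f p))))) (at p)" for p
      using Deriv.has_derivative_inverse[OF assms C_k_SucD(1)[OF Suc.prems], of p] by (simp add: mult.assoc)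
    show "C_k n (\<lambda>p. - 1 * (inverse (f p) * (frechet_derivative f (at p) v * inverse (f p))))" for v
      by (intro C_k_mult[OF C_k_const C_k_mult[OF I C_k_mult[OF C_k_SucD(2)[OF Suc.prems] I]]])
  qed
qed

lemma C_k_sqrt:
  fixes f :: "'a::real_normed_vector \<Rightarrow> real"
  assumes pos: "\<And>p. f p > 0"
  shows "C_k n f \<Longrightarrow> C_k n (\<lambda>p. sqrt (f p))"
proof (induction n)
  case 0
  then show ?case by (simp add: continuous_on_real_sqrt)
next
  case (Suc n)
  have nz: "2 * sqrt (f p) \<noteq> 0" for p
    using pos[of p] by simp
  have I: "C_k n (\<lambda>p. sqrt (f p))"
    by (rule Suc.IH[OF C_k_Suc_imp_C_k[OF Suc.prems]])
  show ?case
  proof (rule C_k_SucI)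
    show "((\<lambda>p. sqrt (f p)) has_derivative
        (\<lambda>v. frechet_derivative f (at p) v * inverse (2 * sqrt (f p)))) (at p)" for p
      by (rule has_derivative_eq_rhs[OF has_derivative_real_sqrt[OF pos C_k_SucD(1)[OF Suc.prems]]])
        (simp add: fun_eq_iff field_simps)
    show "C_k n (\<lambda>p. frechet_derivative f (at p) v * inverse (2 * sqrt (f p)))" for v
      by (intro C_k_mult[OF C_k_SucD(2)[OF Suc.prems]] C_k_inverse[OF nz] C_k_mult[OF C_k_const I])
  qed
qed

lemma frechet_derivative_real:
  fixes f :: "real \<Rightarrow> real"
  assumes "f differentiable (at s)"
  shows "frechet_derivative f (at s) v = deriv f s * v"
proof -
  have "(f has_derivative (\<lambda>v. deriv f s * v)) (at s)"
    using assms by (simp flip: has_field_derivative_def add: DERIV_deriv_iff_real_differentiable)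
  then show ?thesis
    by (simp flip: frechet_derivative_at)
qed

lemma C_k_SucD_real:
  fixes f :: "real \<Rightarrow> real"
  assumes "C_k (Suc n) f"
  shows "(f has_real_derivative deriv f s) (at s)" and "C_k n (deriv f)"
proof -
  have d: "f differentiable (at s)" for s
    using assms by simp
  then show "(f has_real_derivative deriv f s) (at s)"
    by (simp add: DERIV_deriv_iff_real_differentiable)
  have "(\<lambda>s. frechet_derivative f (at s) 1) = deriv f"
    by (rule ext) (simp add: frechet_derivative_real[OF d])
  then show "C_k n (deriv f)"
    using C_k_SucD(2)[OF assms, of 1] by (simp only:)
qed

lemma C_k_SucI_real:
  fixes f :: "real \<Rightarrow> real"
  assumes "\<And>s. (f has_real_derivative f' s) (at s)" and "C_k n f'"
  shows "C_k (Suc n) f"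
proof (rule C_k_SucI)
  show "(f has_derivative (\<lambda>v. f' s * v)) (at s)" for s
    using assms(1) by (simp add: has_field_derivative_def)
  show "C_k n (\<lambda>s. f' s * v)" for v
    by (intro C_k_mult C_k_const assms(2))
qed

text \<open>The outer function has a real argument, so its derivative in the moving direction \<open>g' v\<close> is the
  product of \<open>deriv f\<close> with the real number \<open>g' v\<close>, and the product rule closes the induction.\<close>
lemma C_k_compose_real:
  fixes f :: "real \<Rightarrow> real" and g :: "'a::real_normed_vector \<Rightarrow> real"
  shows "C_k n f \<Longrightarrow> C_k n g \<Longrightarrow> C_k n (\<lambda>p. f (g p))"
proof (induction n arbitrary: f)
  case 0
  then have "continuous_on UNIV f" and "continuous_on UNIV g"
    by simp_all
  then have "continuous_on UNIV (\<lambda>p. f (g p))"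
    by (rule continuous_on_compose2) simp
  then show ?case
    by simp
next
  case (Suc n)
  show ?case
  proof (rule C_k_SucI)
    show "((\<lambda>p. f (g p)) has_derivative
        (\<lambda>v. deriv f (g p) * frechet_derivative g (at p) v)) (at p)" for p
      by (rule has_derivative_compose[OF C_k_SucD(1)[OF Suc.prems(2)]
            C_k_SucD_real(1)[OF Suc.prems(1), unfolded has_field_derivative_def]])
    show "C_k n (\<lambda>p. deriv f (g p) * frechet_derivative g (at p) v)" for v
      by (rule C_k_mult[OF Suc.IH[OF C_k_SucD_real(2)[OF Suc.prems(1)] C_k_Suc_imp_C_k[OF Suc.prems(2)]]
            C_k_SucD(2)[OF Suc.prems(2)]])
  qed
qed

lemma smooth_const: "smooth (\<lambda>p. c)"
  by (simp add: smooth_def C_k_const)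

lemma smooth_add: "smooth f \<Longrightarrow> smooth g \<Longrightarrow> smooth (\<lambda>p. f p + g p)"
  by (simp add: smooth_def C_k_add)

lemma smooth_mult:
  fixes f g :: "'a::real_normed_vector \<Rightarrow> real"
  shows "smooth f \<Longrightarrow> smooth g \<Longrightarrow> smooth (\<lambda>p. f p * g p)"
  by (simp add: smooth_def C_k_mult)

lemma smooth_Pair: "smooth f \<Longrightarrow> smooth g \<Longrightarrow> smooth (\<lambda>p. (f p, g p))"
  by (simp add: smooth_def C_k_Pair)

lemma smooth_divide:
  fixes f g :: "'a::real_normed_vector \<Rightarrow> real"
  shows "smooth f \<Longrightarrow> smooth g \<Longrightarrow> (\<And>p. g p \<noteq> 0) \<Longrightarrow> smooth (\<lambda>p. f p / g p)"
  by (simp add: smooth_def C_k_mult C_k_inverse divide_inverse)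

lemma smooth_sqrt:
  fixes f :: "'a::real_normed_vector \<Rightarrow> real"
  shows "smooth f \<Longrightarrow> (\<And>p. f p > 0) \<Longrightarrow> smooth (\<lambda>p. sqrt (f p))"
  by (simp add: smooth_def C_k_sqrt)

lemma smooth_compose_real:
  fixes f :: "real \<Rightarrow> real" and g :: "'a::real_normed_vector \<Rightarrow> real"
  shows "smooth f \<Longrightarrow> smooth g \<Longrightarrow> smooth (\<lambda>p. f (g p))"
  by (simp add: smooth_def C_k_compose_real)

lemma smooth_bounded_linear: "bounded_linear L \<Longrightarrow> smooth L"
  by (simp add: smooth_def C_k_bounded_linear)

lemma smooth_deriv:
  fixes f :: "real \<Rightarrow> real"
  assumes "smooth f"
  shows "smooth (deriv f)" and "(f has_real_derivative deriv f s) (at s)"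
proof -
  have S: "C_k (Suc n) f" for n
    using assms by (simp only: smooth_def)
  show "smooth (deriv f)"
    unfolding smooth_def using C_k_SucD_real(2)[OF S] ..
  show "(f has_real_derivative deriv f s) (at s)"
    using C_k_SucD_real(1)[OF S[of 0]] .
qed

lemma smooth_antiderivative:
  fixes f :: "real \<Rightarrow> real"
  assumes "\<And>s. (f has_real_derivative f' s) (at s)" and "smooth f'"
  shows "smooth f"
  unfolding smooth_def
proof
  fix n
  show "C_k n f"
    using assms(2) by (intro C_k_Suc_imp_C_k[OF C_k_SucI_real[OF assms(1)]]) (simp only: smooth_def)
qed

text \<open>Bootstrapping: if \<open>f\<close> is of class \<open>C_k n\<close>, then so is the right-hand side \<open>\<alpha> / (\<beta> \<circ> f)\<close>, that is, the
  derivative of \<open>f\<close>. Changes of parameter of the form \<open>\<sigma>\<^sub>2^(-1) \<circ> \<sigma>\<^sub>1\<close> satisfy such an equation, so that they are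
  smooth without a separate inverse function theorem.\<close>
lemma smooth_solution_of_separable_ODE:
  fixes f \<alpha> \<beta> :: "real \<Rightarrow> real"
  assumes f: "\<And>s. (f has_real_derivative \<alpha> s / \<beta> (f s)) (at s)"
    and "smooth \<alpha>" and "smooth \<beta>" and "\<And>s. \<beta> s \<noteq> 0"
  shows "smooth f"
  unfolding smooth_def
proof
  fix n
  show "C_k n f"
  proof (induction n)
    case 0
    then show ?case
      using f DERIV_isCont by (auto simp: continuous_on_eq_continuous_at)
  next
    case (Suc n)
    have "C_k n \<alpha>" and "C_k n \<beta>"
      using assms(2,3) by (simp_all only: smooth_def)
    then have "C_k n (\<lambda>s. \<alpha> s * inverse (\<beta> (f s)))"
      using C_k_compose_real[OF _ Suc] by (intro C_k_mult C_k_inverse assms(4))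
    then show ?case
      by (intro C_k_SucI_real[OF f]) (simp only: divide_inverse)
  qed
qed

section \<open>Eigenvalues of one symmetric form relative to another\<close>

definition bilinear_form :: "real \<Rightarrow> real \<Rightarrow> real \<Rightarrow> real \<times> real \<Rightarrow> real \<times> real \<Rightarrow> real" where
  "bilinear_form E F G u v =
     E * fst u * fst v + F * (fst u * snd v + snd u * fst v) + G * snd u * snd v"

text \<open>A vector \<open>(a, b)\<close> annihilated by the matrix with rows \<open>(p, q)\<close> and \<open>(q, r)\<close> exists off the origin if
  and only if the determinant vanishes; \<open>(q, - p)\<close> is one unless \<open>p = q = 0\<close>.\<close>
lemma eigenvector_iff_singular:
  "(\<exists>u. u \<noteq> 0 \<and> (\<forall>v. bilinear_form L M N u v = k * bilinear_form E F G u v)) \<longleftrightarrow>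
     (L - k * E) * (N - k * G) = (M - k * F)\<^sup>2"
  (is "?lhs \<longleftrightarrow> ?rhs")
proof -
  define p q r where pqr: "p = L - k * E" "q = M - k * F" "r = N - k * G"
  have diff: "bilinear_form L M N u v = k * bilinear_form E F G u v \<longleftrightarrow> bilinear_form p q r u v = 0" for u v
    by (simp add: bilinear_form_def pqr algebra_simps)
  have "?lhs \<longleftrightarrow> p * r = q\<^sup>2"
  proof
    assume ?lhs
    then obtain a b where ab: "(a, b) \<noteq> (0, 0)" and v: "\<And>v. bilinear_form p q r (a, b) v = 0"
      unfolding diff by (auto simp: zero_prod_def)
    have 1: "p * a + q * b = 0" and 2: "q * a + r * b = 0"
      using v[of "(1, 0)"] v[of "(0, 1)"] by (simp_all add: bilinear_form_def)
    have "(p * r - q\<^sup>2) * a = r * (p * a + q * b) - q * (q * a + r * b)"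
      and "(p * r - q\<^sup>2) * b = p * (q * a + r * b) - q * (p * a + q * b)"
      by (simp_all add: algebra_simps power2_eq_square)
    then show "p * r = q\<^sup>2"
      using 1 2 ab by auto
  next
    assume pr: "p * r = q\<^sup>2"
    show ?lhs
    proof (cases "p = 0 \<and> q = 0")
      case True
      then show ?thesis
        unfolding diff by (intro exI[of _ "(1, 0)"]) (auto simp: bilinear_form_def zero_prod_def)
    next
      case False
      have "bilinear_form p q r (q, - p) v = (q\<^sup>2 - p * r) * snd v" for v
        by (simp add: bilinear_form_def algebra_simps power2_eq_square)
      then show ?thesis
        unfolding diff using False pr by (intro exI[of _ "(q, - p)"]) (auto simp: zero_prod_def)
    qed
  qed
  then show ?thesis
    by (simp add: pqr)
qed

text \<open>The relative eigenvalues are the roots of a quadratic polynomial, whose discriminant,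
  up to the factor \<open>E^2\<close>, is a sum of two squares with weights that are positive because the first form is
  definite. Its coefficients then give the sum
  and the product of the least and the greatest root, also in the case of a double root.\<close>
lemma Min_Max_eigenvalues:
  fixes E F G L M N :: real
  assumes "E > 0" and W: "E * G - F\<^sup>2 > 0"
  defines "S \<equiv> {k. \<exists>u. u \<noteq> 0 \<and> (\<forall>v. bilinear_form L M N u v = k * bilinear_form E F G u v)}"
  shows "Min S + Max S = (L * G - 2 * M * F + N * E) / (E * G - F\<^sup>2)"
    and "Min S * Max S = (L * N - M\<^sup>2) / (E * G - F\<^sup>2)"
proof -
  define W B C where WBC: "W = E * G - F\<^sup>2" "B = L * G - 2 * M * F + N * E" "C = L * N - M\<^sup>2"
  have "E\<^sup>2 * (B\<^sup>2 - 4 * W * C) =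
      4 * W * (E * M - F * L)\<^sup>2 + (E * (E * N - G * L) - 2 * F * (E * M - F * L))\<^sup>2"
    unfolding WBC by (simp add: algebra_simps power2_eq_square)
  also have "\<dots> \<ge> 0"
    using W by (simp add: WBC)
  finally have disc: "B\<^sup>2 - 4 * W * C \<ge> 0"
    using \<open>E > 0\<close> by (simp add: zero_le_mult_iff)
  define d where "d = sqrt (B\<^sup>2 - 4 * W * C)"
  have d: "d \<ge> 0" "d\<^sup>2 = B\<^sup>2 - 4 * W * C"
    using disc by (simp_all add: d_def)
  define k1 k2 where k: "k1 = (B - d) / (2 * W)" "k2 = (B + d) / (2 * W)"
  have Wpos: "W > 0"
    using W by (simp add: WBC)
  have sum: "k1 + k2 = B / W"
    using Wpos by (simp add: k field_simps)
  have "k1 * k2 = (B\<^sup>2 - d\<^sup>2) / (2 * W)\<^sup>2"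
    by (simp add: k algebra_simps power2_eq_square)
  also have "B\<^sup>2 - d\<^sup>2 = 4 * W * C"
    using d(2) by simp
  also have "4 * W * C / (2 * W)\<^sup>2 = C / W"
    using Wpos by (simp add: field_simps power2_eq_square)
  finally have prod: "k1 * k2 = C / W" .
  have "(L - k * E) * (N - k * G) = (M - k * F)\<^sup>2 \<longleftrightarrow> k \<in> {k1, k2}" for k
  proof -
    have "(L - k * E) * (N - k * G) - (M - k * F)\<^sup>2 = W * k\<^sup>2 - B * k + C"
      unfolding WBC by (simp add: algebra_simps power2_eq_square)
    also have "\<dots> = W * (k\<^sup>2 - (k1 + k2) * k + k1 * k2)"
      unfolding sum prod using Wpos by (simp add: field_simps)
    also have "\<dots> = W * ((k - k1) * (k - k2))"
      by (simp add: algebra_simps power2_eq_square)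
    finally show ?thesis
      using Wpos by auto
  qed
  then have S: "S = {k1, k2}"
    unfolding S_def eigenvector_iff_singular by auto
  have "k1 \<le> k2"
    using d(1) Wpos by (simp add: k divide_right_mono)
  then have "Min S = k1" "Max S = k2"
    by (simp_all add: S)
  then show "Min S + Max S = (L * G - 2 * M * F + N * E) / (E * G - F\<^sup>2)"
    and "Min S * Max S = (L * N - M\<^sup>2) / (E * G - F\<^sup>2)"
    using sum prod by (simp_all add: WBC)
qed

text \<open>The coordinates of a vector in the frame that rotates about the axis of the screw motion, with
  \<open>b\<close> along the axis. Inner and cross products can be computed in this frame.\<close>
definition rotated :: "real \<Rightarrow> real \<Rightarrow> real \<Rightarrow> real \<Rightarrow> real ^ 3" where
  "rotated \<theta> a b c = vector [a * cos \<theta> + c * sin \<theta>, b, - a * sin \<theta> + c * cos \<theta>]"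

lemma rotated_product_identities:
  fixes a c a' c' \<theta> :: real
  shows "(a * cos \<theta> + c * sin \<theta>) * (a' * cos \<theta> + c' * sin \<theta>) +
      (- a * sin \<theta> + c * cos \<theta>) * (- a' * sin \<theta> + c' * cos \<theta>) = a * a' + c * c'"
    and "(- a * sin \<theta> + c * cos \<theta>) * (a' * cos \<theta> + c' * sin \<theta>) -
      (a * cos \<theta> + c * sin \<theta>) * (- a' * sin \<theta> + c' * cos \<theta>) = c * a' - a * c'"
proof -
  have "(a * cos \<theta> + c * sin \<theta>) * (a' * cos \<theta> + c' * sin \<theta>) +
      (- a * sin \<theta> + c * cos \<theta>) * (- a' * sin \<theta> + c' * cos \<theta>) =
      (a * a' + c * c') * ((sin \<theta>)\<^sup>2 + (cos \<theta>)\<^sup>2)"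
    by algebra
  then show "(a * cos \<theta> + c * sin \<theta>) * (a' * cos \<theta> + c' * sin \<theta>) +
      (- a * sin \<theta> + c * cos \<theta>) * (- a' * sin \<theta> + c' * cos \<theta>) = a * a' + c * c'"
    by (simp only: sin_cos_squared_add mult_1_right)
  have "(- a * sin \<theta> + c * cos \<theta>) * (a' * cos \<theta> + c' * sin \<theta>) -
      (a * cos \<theta> + c * sin \<theta>) * (- a' * sin \<theta> + c' * cos \<theta>) =
      (c * a' - a * c') * ((sin \<theta>)\<^sup>2 + (cos \<theta>)\<^sup>2)"
    by algebra
  then show "(- a * sin \<theta> + c * cos \<theta>) * (a' * cos \<theta> + c' * sin \<theta>) -
      (a * cos \<theta> + c * sin \<theta>) * (- a' * sin \<theta> + c' * cos \<theta>) = c * a' - a * c'"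
    by (simp only: sin_cos_squared_add mult_1_right)
qed

lemma inner_rotated: "rotated \<theta> a b c \<bullet> rotated \<theta> a' b' c' = a * a' + b * b' + c * c'"
  using rotated_product_identities(1)[of a \<theta> c a' c']
  by (simp add: rotated_def inner_vec_def sum_3)

lemma cross3_rotated:
  "cross3 (rotated \<theta> a b c) (rotated \<theta> a' b' c') =
     rotated \<theta> (b * c' - c * b') (c * a' - a * c') (a * b' - b * a')"
  using rotated_product_identities(2)[of a \<theta> c a' c']
  by (simp add: rotated_def cross3_def vec_eq_iff forall_3 algebra_simps)

lemma norm_rotated: "norm (rotated \<theta> a b c) = sqrt (a\<^sup>2 + b\<^sup>2 + c\<^sup>2)"
  by (simp add: norm_eq_sqrt_inner inner_rotated power2_eq_square)

lemma has_derivative_vector3: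
  fixes f g h :: "'a::real_normed_vector \<Rightarrow> real"
  assumes "(f has_derivative f') (at p)" "(g has_derivative g') (at p)" "(h has_derivative h') (at p)"
  shows "((\<lambda>p. vector [f p, g p, h p] :: real ^ 3) has_derivative (\<lambda>v. vector [f' v, g' v, h' v])) (at p)"
proof -
  have expand: "(vector [a, b, c] :: real ^ 3) =
      a *\<^sub>R axis 1 1 + b *\<^sub>R axis 2 1 + c *\<^sub>R axis 3 1" for a b c :: real
    by (simp add: vec_eq_iff forall_3 axis_def)
  show ?thesis
    unfolding expand using assms by (auto intro!: derivative_eq_intros)
qed

text \<open>Vector fields along the surface whose rotating coordinates depend on \<open>s\<close> alone, up to a component
  \<open>m t\<close> along the axis. The immersion and all its directional derivatives are of this kind, so a single
  differentiation rule yields both fundamental forms.\<close>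
definition screw :: "real \<Rightarrow> (real \<Rightarrow> real) \<Rightarrow> (real \<Rightarrow> real) \<Rightarrow> (real \<Rightarrow> real) \<Rightarrow> surface" where
  "screw w X m Z p = rotated (w * snd p) (X (fst p)) (m (snd p)) (Z (fst p))"

lemma twizzler_map_eq_screw: "twizzler_map w x z = screw w x (\<lambda>t. t) z"
  by (auto simp: twizzler_map_def screw_def rotated_def)

lemma frechet_derivative_screw:
  assumes "\<And>s. (X has_real_derivative X' s) (at s)" and "\<And>s. (Z has_real_derivative Z' s) (at s)"
    and "\<And>t. (m has_real_derivative m') (at t)"
  shows "frechet_derivative (screw w X m Z) (at p) v =
     screw w (\<lambda>s. fst v * X' s + snd v * w * Z s) (\<lambda>t. snd v * m') (\<lambda>s. fst v * Z' s - snd v * w * X s) p"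
proof -
  have X: "((\<lambda>p. X (fst p)) has_derivative (\<lambda>v. X' (fst p) * fst v)) (at p)"
    by (rule has_derivative_compose[OF has_derivative_fst[OF has_derivative_ident]
          assms(1)[unfolded has_field_derivative_def]])
  have Z: "((\<lambda>p. Z (fst p)) has_derivative (\<lambda>v. Z' (fst p) * fst v)) (at p)"
    by (rule has_derivative_compose[OF has_derivative_fst[OF has_derivative_ident]
          assms(2)[unfolded has_field_derivative_def]])
  have m: "((\<lambda>p. m (snd p)) has_derivative (\<lambda>v. m' * snd v)) (at p)"
    by (rule has_derivative_compose[OF has_derivative_snd[OF has_derivative_ident]
          assms(3)[unfolded has_field_derivative_def]])
  have \<theta>: "((\<lambda>p. w * snd p) has_derivative (\<lambda>v. w * snd v)) (at p)"
    by (intro has_derivative_mult_right has_derivative_snd has_derivative_ident)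
  note C = has_derivative_cos[OF \<theta>] and S = has_derivative_sin[OF \<theta>]
  have "(screw w X m Z has_derivative (\<lambda>v. screw w (\<lambda>s. fst v * X' s + snd v * w * Z s)
     (\<lambda>t. snd v * m') (\<lambda>s. fst v * Z' s - snd v * w * X s) p)) (at p)"
    unfolding screw_def[abs_def] rotated_def
    by (rule has_derivative_eq_rhs, rule has_derivative_vector3[OF
        has_derivative_add[OF has_derivative_mult[OF X C] has_derivative_mult[OF Z S]] m
        has_derivative_add[OF has_derivative_mult[OF has_derivative_minus[OF X] S]
          has_derivative_mult[OF Z C]]])
      (simp add: fun_eq_iff algebra_simps)
  then show ?thesis
    by (simp flip: frechet_derivative_at)
qed

section \<open>Heights and phases\<close>

lemma antiderivative_exists:
  fixes f :: "real \<Rightarrow> real"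
  assumes "continuous_on UNIV f"
  shows "\<exists>F. \<forall>s. (F has_real_derivative f s) (at s)"
proof -
  have "\<exists>F. \<forall>s::real. - \<infinity> < ereal s \<longrightarrow> ereal s < \<infinity> \<longrightarrow> (F has_vector_derivative f s) (at s)"
    using assms by (intro einterval_antiderivative) (auto simp: continuous_on_eq_continuous_at)
  then show ?thesis
    by (auto simp: has_real_derivative_iff_has_vector_derivative)
qed

lemma bij_if_derivative_bounded_below:
  fixes \<sigma> :: "real \<Rightarrow> real"
  assumes deriv: "\<And>s. (\<sigma> has_real_derivative \<alpha> s) (at s)"
    and below: "\<And>s. e \<le> \<alpha> s" and "e > 0"
  shows "bij \<sigma>"
proof -
  have mono: "e * (t - s) \<le> \<sigma> t - \<sigma> s" if "s \<le> t" for s t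
  proof (cases "s = t")
    case False
    then have "s < t"
      using that by simp
    then obtain r where "\<sigma> t - \<sigma> s = (t - s) * \<alpha> r"
      using MVT2[of s t \<sigma> \<alpha>] deriv by blast
    then show ?thesis
      using mult_right_mono[OF below[of r], of "t - s"] that by (simp add: mult.commute)
  qed simp
  have "\<sigma> s < \<sigma> t" if "s < t" for s t
    using mono[of s t] that \<open>e > 0\<close> by (smt (verit) mult_pos_pos)
  then have "inj \<sigma>"
    by (intro linorder_injI) (metis less_irrefl)
  moreover have "\<exists>s. \<sigma> s = b" for b
  proof -
    define r where "r = \<bar>b - \<sigma> 0\<bar> / e"
    have "r \<ge> 0" and er: "e * r = \<bar>b - \<sigma> 0\<bar>"
      using \<open>e > 0\<close> by (simp_all add: r_def)
    have "\<sigma> (- r) \<le> b" and "b \<le> \<sigma> r"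
      using mono[of "- r" 0] mono[of 0 r] er \<open>r \<ge> 0\<close> by auto
    moreover have "\<forall>s. - r \<le> s \<and> s \<le> r \<longrightarrow> isCont \<sigma> s"
      using deriv DERIV_isCont by blast
    ultimately show ?thesis
      using IVT[of \<sigma> "- r" b r] \<open>r \<ge> 0\<close> by auto
  qed
  ultimately show ?thesis
    by (auto simp: bij_def surj_def) metis
qed

text \<open>The pair \<open>(P, Q)\<close> moves on a circle with angular velocity \<open>- 2 \<alpha>\<close>; turned back by the angle \<open>2 \<sigma>\<close> it
  becomes a constant point of this circle, whose polar angle is the phase.\<close>
lemma phase_of_rotating_pair:
  fixes P Q \<alpha> \<sigma> :: "real \<Rightarrow> real"
  assumes P: "\<And>s. (P has_real_derivative 2 * Q s * \<alpha> s) (at s)"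
    and Q: "\<And>s. (Q has_real_derivative - 2 * P s * \<alpha> s) (at s)"
    and \<sigma>: "\<And>s. (\<sigma> has_real_derivative \<alpha> s) (at s)"
    and norm: "\<And>s. (P s)\<^sup>2 + (Q s)\<^sup>2 = a\<^sup>2" and "a > 0"
  shows "\<exists>\<delta>. \<forall>s. P s = a * cos (2 * (\<sigma> s + \<delta>))"
proof -
  define C where "C s = P s * cos (2 * \<sigma> s) - Q s * sin (2 * \<sigma> s)" for s
  define S where "S s = P s * sin (2 * \<sigma> s) + Q s * cos (2 * \<sigma> s)" for s
  have "(C has_real_derivative 0) (at s)" for s
    unfolding C_def[abs_def]
    by (rule derivative_eq_intros P Q \<sigma> refl)+ (simp add: algebra_simps)
  then have C: "C s = C 0" for s
    using DERIV_isconst_all by blast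
  have "(S has_real_derivative 0) (at s)" for s
    unfolding S_def[abs_def]
    by (rule derivative_eq_intros P Q \<sigma> refl)+ (simp add: algebra_simps)
  then have S: "S s = S 0" for s
    using DERIV_isconst_all by blast
  have "(C 0)\<^sup>2 + (S 0)\<^sup>2 = ((P 0)\<^sup>2 + (Q 0)\<^sup>2) * ((sin (2 * \<sigma> 0))\<^sup>2 + (cos (2 * \<sigma> 0))\<^sup>2)"
    unfolding C_def S_def by algebra
  then have "(C 0 / a)\<^sup>2 + (S 0 / a)\<^sup>2 = 1"
    using norm[of 0] \<open>a > 0\<close> by (simp add: power_divide flip: add_divide_distrib)
  then obtain \<theta> where \<theta>: "C 0 / a = cos \<theta>" "S 0 / a = sin \<theta>"
    using sincos_total_2pi by metis
  have "P s = a * cos (2 * (\<sigma> s + - \<theta> / 2))" for s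
  proof -
    have "C s * cos (2 * \<sigma> s) + S s * sin (2 * \<sigma> s) =
        P s * ((sin (2 * \<sigma> s))\<^sup>2 + (cos (2 * \<sigma> s))\<^sup>2)"
      unfolding C_def S_def by algebra
    then have "P s = C 0 * cos (2 * \<sigma> s) + S 0 * sin (2 * \<sigma> s)"
      using C[of s] S[of s] by simp
    also have "\<dots> = a * cos (2 * \<sigma> s - \<theta>)"
      using \<theta> \<open>a > 0\<close> by (simp add: cos_diff field_simps)
    finally show ?thesis
      by (simp add: algebra_simps)
  qed
  then show ?thesis
    by blast
qed

section \<open>Surfaces swept out by a screw motion\<close>

text \<open>Here \<open>\<kappa>\<close> is the curvature of the profile curve, \<open>G\<close> the squared length of \<open>\<phi>_t\<close>, and \<open>D\<close> the area
  element \<open>|\<phi>_s \<times> \<phi>_t|\<close>.\<close>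
locale twisted_profile =
  fixes w :: real and x z :: "real \<Rightarrow> real"
  assumes smooth_profile: "smooth x" "smooth z"
    and arc_length: "(deriv x s)\<^sup>2 + (deriv z s)\<^sup>2 = 1"
begin

definition \<kappa> :: "real \<Rightarrow> real" where
  "\<kappa> s = deriv x s * deriv (deriv z) s - deriv z s * deriv (deriv x) s"

definition G :: "real \<Rightarrow> real" where
  "G s = 1 + w\<^sup>2 * ((x s)\<^sup>2 + (z s)\<^sup>2)"

definition D :: "real \<Rightarrow> real" where
  "D s = sqrt (1 + w\<^sup>2 * (\<xi>\<^sub>1 x z s)\<^sup>2)"

abbreviation \<phi> :: surface where
  "\<phi> \<equiv> twizzler_map w x z"

lemma smooth_tangent: "smooth (deriv x)" "smooth (deriv z)"
  by (simp_all add: smooth_deriv smooth_profile)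

lemmas profile_derivatives =
  smooth_deriv(2)[OF smooth_profile(1)] smooth_deriv(2)[OF smooth_profile(2)]
  smooth_deriv(2)[OF smooth_tangent(1)] smooth_deriv(2)[OF smooth_tangent(2)]

text \<open>The tangent is a unit vector, hence orthogonal to its derivative.\<close>
lemma Frenet:
  "deriv (deriv x) s = - \<kappa> s * deriv z s" "deriv (deriv z) s = \<kappa> s * deriv x s"
proof -
  have "((\<lambda>s. (deriv x s)\<^sup>2 + (deriv z s)\<^sup>2) has_real_derivative
      2 * deriv x s * deriv (deriv x) s + 2 * deriv z s * deriv (deriv z) s) (at s)"
    by (rule profile_derivatives derivative_eq_intros refl)+ simp
  then have "((\<lambda>s. 1) has_real_derivative
      2 * deriv x s * deriv (deriv x) s + 2 * deriv z s * deriv (deriv z) s) (at s)"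
    by (simp only: arc_length)
  from DERIV_unique[OF this DERIV_const]
  have orth: "deriv x s * deriv (deriv x) s + deriv z s * deriv (deriv z) s = 0"
    by simp
  have "deriv (deriv x) s * ((deriv x s)\<^sup>2 + (deriv z s)\<^sup>2) =
      - \<kappa> s * deriv z s + deriv x s * (deriv x s * deriv (deriv x) s + deriv z s * deriv (deriv z) s)"
    and "deriv (deriv z) s * ((deriv x s)\<^sup>2 + (deriv z s)\<^sup>2) =
      \<kappa> s * deriv x s + deriv z s * (deriv x s * deriv (deriv x) s + deriv z s * deriv (deriv z) s)"
    unfolding \<kappa>_def by (simp_all add: algebra_simps power2_eq_square)
  then show "deriv (deriv x) s = - \<kappa> s * deriv z s" "deriv (deriv z) s = \<kappa> s * deriv x s"
    unfolding orth arc_length by simp_all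
qed

lemma \<xi>_norm: "(\<xi>\<^sub>1 x z s)\<^sup>2 + (\<xi>\<^sub>2 x z s)\<^sup>2 = (x s)\<^sup>2 + (z s)\<^sup>2"
proof -
  have "(\<xi>\<^sub>1 x z s)\<^sup>2 + (\<xi>\<^sub>2 x z s)\<^sup>2 =
      ((x s)\<^sup>2 + (z s)\<^sup>2) * ((deriv x s)\<^sup>2 + (deriv z s)\<^sup>2)"
    unfolding \<xi>\<^sub>1_def \<xi>\<^sub>2_def by (simp add: algebra_simps power2_eq_square)
  then show ?thesis
    by (simp add: arc_length)
qed

lemma D_square: "(D s)\<^sup>2 = 1 + w\<^sup>2 * (\<xi>\<^sub>1 x z s)\<^sup>2"
  by (simp add: D_def)

lemma D_ge_1: "D s \<ge> 1"
  by (simp add: D_def)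

lemma D_pos: "D s > 0"
  using D_ge_1[of s] by linarith

lemma G_eq: "G s = (D s)\<^sup>2 + w\<^sup>2 * (\<xi>\<^sub>2 x z s)\<^sup>2"
  unfolding G_def D_square \<xi>_norm[symmetric] by (simp add: algebra_simps power2_eq_square)

lemma G_pos: "G s > 0"
  by (simp add: G_def add_pos_nonneg)

lemma \<xi>\<^sub>1_deriv: "(\<xi>\<^sub>1 x z has_real_derivative 1 + \<kappa> s * \<xi>\<^sub>2 x z s) (at s)"
proof -
  have "((\<lambda>s. x s * deriv x s + z s * deriv z s) has_real_derivative
      ((deriv x s)\<^sup>2 + (deriv z s)\<^sup>2) + (x s * deriv (deriv x) s + z s * deriv (deriv z) s)) (at s)"
    by (rule profile_derivatives derivative_eq_intros refl)+ (simp add: power2_eq_square)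
  then show ?thesis
    unfolding arc_length Frenet by (simp add: \<xi>\<^sub>1_def[abs_def] \<xi>\<^sub>2_def algebra_simps)
qed

lemma \<xi>\<^sub>2_deriv: "(\<xi>\<^sub>2 x z has_real_derivative - \<kappa> s * \<xi>\<^sub>1 x z s) (at s)"
proof -
  have "((\<lambda>s. - x s * deriv z s + z s * deriv x s) has_real_derivative
      - x s * deriv (deriv z) s + z s * deriv (deriv x) s) (at s)"
    by (rule profile_derivatives derivative_eq_intros refl)+ (simp add: algebra_simps)
  then show ?thesis
    unfolding Frenet by (simp add: \<xi>\<^sub>2_def[abs_def] \<xi>\<^sub>1_def algebra_simps)
qed

lemma G_deriv: "(G has_real_derivative 2 * w\<^sup>2 * \<xi>\<^sub>1 x z s) (at s)"
  unfolding G_def[abs_def] \<xi>\<^sub>1_def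
  by (rule profile_derivatives derivative_eq_intros refl)+ (simp add: algebra_simps)

lemma D_deriv: "(D has_real_derivative w\<^sup>2 * \<xi>\<^sub>1 x z s * (1 + \<kappa> s * \<xi>\<^sub>2 x z s) / D s) (at s)"
proof -
  define R where "R s = 1 + w\<^sup>2 * (\<xi>\<^sub>1 x z s)\<^sup>2" for s
  have R: "(R has_real_derivative 2 * (w\<^sup>2 * \<xi>\<^sub>1 x z s * (1 + \<kappa> s * \<xi>\<^sub>2 x z s))) (at s)"
    unfolding R_def[abs_def] by (rule \<xi>\<^sub>1_deriv derivative_eq_intros refl)+ simp
  have half: "inverse a / 2 * (2 * b) = b / a" for a b :: real
    by (simp add: field_simps)
  have pos: "R s > 0"
    by (simp add: R_def add_pos_nonneg)
  have "((\<lambda>s. sqrt (R s)) has_real_derivative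
      w\<^sup>2 * \<xi>\<^sub>1 x z s * (1 + \<kappa> s * \<xi>\<^sub>2 x z s) / sqrt (R s)) (at s)"
    by (rule DERIV_cong[OF DERIV_chain2[where f = sqrt and g = R, OF DERIV_real_sqrt[OF pos] R]])
      (rule half)
  then show ?thesis
    by (simp add: D_def[abs_def] R_def)
qed

lemma first_derivative:
  "frechet_derivative \<phi> (at p) v =
     screw w (\<lambda>s. fst v * deriv x s + snd v * w * z s) (\<lambda>t. snd v)
       (\<lambda>s. fst v * deriv z s - snd v * w * x s) p"
  unfolding twizzler_map_eq_screw
  using frechet_derivative_screw[OF profile_derivatives(1,2) DERIV_ident, of w p v]
  by (simp only: mult_1_right)

lemma induced_metric_\<phi>:
  "induced_metric \<phi> p u v = bilinear_form 1 (w * \<xi>\<^sub>2 x z (fst p)) (G (fst p)) u v"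
proof -
  define s where "s = fst p"
  have "induced_metric \<phi> p u v =
      fst u * fst v * ((deriv x s)\<^sup>2 + (deriv z s)\<^sup>2) +
      w * \<xi>\<^sub>2 x z s * (fst u * snd v + snd u * fst v) + G s * snd u * snd v"
    unfolding induced_metric_def first_derivative screw_def inner_rotated s_def[symmetric] \<xi>\<^sub>2_def G_def
    by (simp add: algebra_simps power2_eq_square)
  then show ?thesis
    by (simp add: arc_length bilinear_form_def s_def)
qed

lemma unit_normal_\<phi>:
  "unit_normal \<phi> p =
     rotated (w * snd p) (- deriv z (fst p)) (w * \<xi>\<^sub>1 x z (fst p)) (deriv x (fst p)) /\<^sub>R D (fst p)"
proof -
  define s where "s = fst p"
  have cross: "cross3 (frechet_derivative \<phi> (at p) (1, 0)) (frechet_derivative \<phi> (at p) (0, 1)) =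
      rotated (w * snd p) (- deriv z s) (w * \<xi>\<^sub>1 x z s) (deriv x s)"
    unfolding first_derivative screw_def cross3_rotated s_def \<xi>\<^sub>1_def by (simp add: algebra_simps)
  have "norm (rotated (w * snd p) (- deriv z s) (w * \<xi>\<^sub>1 x z s) (deriv x s)) = D s"
    using arc_length[of s] by (simp add: norm_rotated D_def power_mult_distrib algebra_simps)
  then show ?thesis
    unfolding unit_normal_def Let_def cross s_def by simp
qed

lemma second_fundamental_form_\<phi>:
  "second_fundamental_form \<phi> p u v =
     bilinear_form (\<kappa> (fst p) / D (fst p)) (- w / D (fst p))
       (- w\<^sup>2 * \<xi>\<^sub>2 x z (fst p) / D (fst p)) u v"
proof -
  define s where "s = fst p"
  have X: "((\<lambda>s. fst v * deriv x s + snd v * w * z s) has_real_derivative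
      fst v * deriv (deriv x) s + snd v * w * deriv z s) (at s)" for s
    by (rule profile_derivatives derivative_eq_intros refl)+ simp
  have Z: "((\<lambda>s. fst v * deriv z s - snd v * w * x s) has_real_derivative
      fst v * deriv (deriv z) s - snd v * w * deriv x s) (at s)" for s
    by (rule profile_derivatives derivative_eq_intros refl)+ simp
  have first: "(\<lambda>q. frechet_derivative \<phi> (at q) v) =
      screw w (\<lambda>s. fst v * deriv x s + snd v * w * z s) (\<lambda>t. snd v)
        (\<lambda>s. fst v * deriv z s - snd v * w * x s)"
    by (rule ext) (rule first_derivative)
  have "second_fundamental_form \<phi> p u v =
      (fst u * fst v * \<kappa> s * ((deriv x s)\<^sup>2 + (deriv z s)\<^sup>2)
       - w * (fst u * snd v + snd u * fst v) * ((deriv x s)\<^sup>2 + (deriv z s)\<^sup>2)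
       - w\<^sup>2 * \<xi>\<^sub>2 x z s * snd u * snd v) / D s"
    unfolding second_fundamental_form_def first frechet_derivative_screw[OF X Z DERIV_const]
      unit_normal_\<phi> screw_def inner_scaleR_right inner_rotated Frenet s_def[symmetric] \<xi>\<^sub>2_def
    using D_pos[of s] by (simp add: field_simps power2_eq_square)
  also have "\<dots> = bilinear_form (\<kappa> s) (- w) (- w\<^sup>2 * \<xi>\<^sub>2 x z s) u v / D s"
    by (simp add: arc_length bilinear_form_def algebra_simps)
  also have "\<dots> = bilinear_form (\<kappa> s / D s) (- w / D s) (- w\<^sup>2 * \<xi>\<^sub>2 x z s / D s) u v"
    by (simp add: bilinear_form_def add_divide_distrib diff_divide_distrib)
  finally show ?thesis
    by (simp only: s_def)
qed

lemma curvatures: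
  "2 * mean_curvature \<phi> p =
     (\<kappa> (fst p) * G (fst p) + w\<^sup>2 * \<xi>\<^sub>2 x z (fst p)) / (D (fst p)) ^ 3" (is "?H")
  "gauss_curvature \<phi> p = - w\<^sup>2 * (1 + \<kappa> (fst p) * \<xi>\<^sub>2 x z (fst p)) / (D (fst p)) ^ 4" (is "?K")
proof -
  define s where "s = fst p"
  have W: "1 * G s - (w * \<xi>\<^sub>2 x z s)\<^sup>2 = (D s)\<^sup>2"
    by (simp add: G_eq power_mult_distrib)
  define S where "S = principal_curvatures \<phi> p"
  have S: "S = {k. \<exists>u. u \<noteq> 0 \<and> (\<forall>v.
      bilinear_form (\<kappa> s / D s) (- w / D s) (- w\<^sup>2 * \<xi>\<^sub>2 x z s / D s) u v =
      k * bilinear_form 1 (w * \<xi>\<^sub>2 x z s) (G s) u v)}"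
    unfolding S_def principal_curvatures_def induced_metric_\<phi> second_fundamental_form_\<phi> s_def ..
  have "1 * G s - (w * \<xi>\<^sub>2 x z s)\<^sup>2 > 0"
    unfolding W using D_pos[of s] by simp
  note eigen = Min_Max_eigenvalues[OF zero_less_one this, unfolded W,
      of "\<kappa> s / D s" "- w / D s" "- w\<^sup>2 * \<xi>\<^sub>2 x z s / D s", folded S]
  have "Min S + Max S = (\<kappa> s * G s + w\<^sup>2 * \<xi>\<^sub>2 x z s) / (D s) ^ 3"
    unfolding eigen(1) using D_pos[of s] by (simp add: field_simps power2_eq_square power3_eq_cube)
  moreover have "2 * mean_curvature \<phi> p = Min S + Max S"
    by (simp add: mean_curvature_def S_def)
  ultimately show ?H
    by (simp add: s_def)
  have "Min S * Max S = - w\<^sup>2 * (1 + \<kappa> s * \<xi>\<^sub>2 x z s) / (D s) ^ 4"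
    unfolding eigen(2) using D_pos[of s] by (simp add: field_simps power2_eq_square power4_eq_xxxx)
  then show ?K
    by (simp add: gauss_curvature_def S_def s_def)
qed

end

section \<open>Isometries of warped metrics\<close>

text \<open>The map that sends a parameter of the first surface to the parameter of the second surface with
  the same height.\<close>
lemma change_of_height:
  fixes \<sigma>\<^sub>1 \<sigma>\<^sub>2 :: "real \<Rightarrow> real"
  assumes \<sigma>\<^sub>1: "\<And>s. (\<sigma>\<^sub>1 has_real_derivative \<alpha>\<^sub>1 s) (at s)" and \<sigma>\<^sub>2: "\<And>s. (\<sigma>\<^sub>2 has_real_derivative \<alpha>\<^sub>2 s) (at s)"
    and smooth: "smooth \<alpha>\<^sub>1" "smooth \<alpha>\<^sub>2" and nz: "\<And>s. \<alpha>\<^sub>2 s \<noteq> 0" and "bij \<sigma>\<^sub>2"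
  shows "((\<lambda>s. inv \<sigma>\<^sub>2 (\<sigma>\<^sub>1 s)) has_real_derivative \<alpha>\<^sub>1 s / \<alpha>\<^sub>2 (inv \<sigma>\<^sub>2 (\<sigma>\<^sub>1 s))) (at s)"
    and "smooth (\<lambda>s. inv \<sigma>\<^sub>2 (\<sigma>\<^sub>1 s))"
proof -
  have inv: "\<sigma>\<^sub>2 (inv \<sigma>\<^sub>2 b) = b" "inv \<sigma>\<^sub>2 (\<sigma>\<^sub>2 s) = s" for b s
    using \<open>bij \<sigma>\<^sub>2\<close> by (simp_all add: bij_is_surj surj_f_inv_f bij_is_inj)
  have "isCont (inv \<sigma>\<^sub>2) (\<sigma>\<^sub>2 s)" for s
    by (rule isCont_inverse_function[of 1]) (auto simp: inv intro: DERIV_isCont[OF \<sigma>\<^sub>2])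
  then have "isCont (inv \<sigma>\<^sub>2) b" for b
    by (metis inv(1))
  then have "(inv \<sigma>\<^sub>2 has_real_derivative inverse (\<alpha>\<^sub>2 (inv \<sigma>\<^sub>2 b))) (at b)" for b
    by (intro DERIV_inverse_function[of \<sigma>\<^sub>2 _ _ _ "b - 1" "b + 1"]) (simp_all add: inv nz \<sigma>\<^sub>2)
  from DERIV_chain2[where f = "inv \<sigma>\<^sub>2" and g = \<sigma>\<^sub>1, OF this \<sigma>\<^sub>1]
  have deriv: "((\<lambda>s. inv \<sigma>\<^sub>2 (\<sigma>\<^sub>1 s)) has_real_derivative \<alpha>\<^sub>1 s / \<alpha>\<^sub>2 (inv \<sigma>\<^sub>2 (\<sigma>\<^sub>1 s))) (at s)" for s
    by (metis divide_inverse mult.commute)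
  show "((\<lambda>s. inv \<sigma>\<^sub>2 (\<sigma>\<^sub>1 s)) has_real_derivative \<alpha>\<^sub>1 s / \<alpha>\<^sub>2 (inv \<sigma>\<^sub>2 (\<sigma>\<^sub>1 s))) (at s)"
    by (rule deriv)
  show "smooth (\<lambda>s. inv \<sigma>\<^sub>2 (\<sigma>\<^sub>1 s))"
    using smooth_solution_of_separable_ODE[OF deriv smooth nz] .
qed

lemma smooth_fibre_preserving:
  fixes f h :: "real \<Rightarrow> real"
  assumes "smooth f" "smooth h"
  shows "smooth (\<lambda>p::real \<times> real. (f (fst p), k * snd p + h (fst p)))"
  by (intro smooth_Pair smooth_add smooth_mult smooth_const smooth_compose_real[OF assms(1)]
      smooth_compose_real[OF assms(2)] smooth_bounded_linear bounded_linear_fst bounded_linear_snd)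

lemma frechet_derivative_fibre_preserving:
  fixes f h :: "real \<Rightarrow> real"
  assumes "\<And>s. (f has_real_derivative f' s) (at s)" and "\<And>s. (h has_real_derivative h' s) (at s)"
  shows "frechet_derivative (\<lambda>p. (f (fst p), k * snd p + h (fst p))) (at p) u =
     (f' (fst p) * fst u, k * snd u + h' (fst p) * fst u)"
proof -
  have "((\<lambda>p. f (fst p)) has_derivative (\<lambda>u. f' (fst p) * fst u)) (at p)"
    by (rule has_derivative_compose[OF has_derivative_fst[OF has_derivative_ident]
          assms(1)[unfolded has_field_derivative_def]])
  moreover have "((\<lambda>p. h (fst p)) has_derivative (\<lambda>u. h' (fst p) * fst u)) (at p)"
    by (rule has_derivative_compose[OF has_derivative_fst[OF has_derivative_ident]
          assms(2)[unfolded has_field_derivative_def]])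
  moreover have "((\<lambda>p. k * snd p) has_derivative (\<lambda>u. k * snd u)) (at p)"
    by (intro has_derivative_mult_right has_derivative_snd has_derivative_ident)
  ultimately have "((\<lambda>p. (f (fst p), k * snd p + h (fst p))) has_derivative
      (\<lambda>u. (f' (fst p) * fst u, k * snd u + h' (fst p) * fst u))) (at p)"
    by (intro has_derivative_Pair has_derivative_add)
  then show ?thesis
    by (simp flip: frechet_derivative_at)
qed

text \<open>In the coordinates \<open>(\<sigma>, t + \<tau>)\<close> of both planes this is \<open>(r, T) -> (r, k T)\<close>.\<close>
definition aligning_map ::
  "(real \<Rightarrow> real) \<Rightarrow> (real \<Rightarrow> real) \<Rightarrow> (real \<Rightarrow> real) \<Rightarrow> (real \<Rightarrow> real) \<Rightarrow> real \<Rightarrow> real \<times> real \<Rightarrow> real \<times> real" where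
  "aligning_map \<sigma>\<^sub>1 \<tau>\<^sub>1 \<sigma>\<^sub>2 \<tau>\<^sub>2 k = (\<lambda>p. (inv \<sigma>\<^sub>2 (\<sigma>\<^sub>1 (fst p)),
     k * snd p + (k * \<tau>\<^sub>1 (fst p) - \<tau>\<^sub>2 (inv \<sigma>\<^sub>2 (\<sigma>\<^sub>1 (fst p))))))"

lemma aligning_map_inverse:
  assumes "bij \<sigma>\<^sub>1" "bij \<sigma>\<^sub>2" "k \<noteq> 0"
  shows "aligning_map \<sigma>\<^sub>2 \<tau>\<^sub>2 \<sigma>\<^sub>1 \<tau>\<^sub>1 (1 / k) (aligning_map \<sigma>\<^sub>1 \<tau>\<^sub>1 \<sigma>\<^sub>2 \<tau>\<^sub>2 k p) = p"
  using assms
  by (simp add: aligning_map_def bij_is_surj surj_f_inv_f bij_is_inj prod_eq_iff field_simps)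

text \<open>Passing from \<open>(s, t)\<close> to \<open>(\<sigma> s, t + \<tau> s)\<close> straightens the metric below to a warped product
  \<open>d\<sigma>^2 + \<rho>(\<sigma>) dT^2\<close>.\<close>
locale straightening =
  fixes \<sigma> \<tau> \<alpha> \<beta> :: "real \<Rightarrow> real"
  assumes \<sigma>: "\<And>s. (\<sigma> has_real_derivative \<alpha> s) (at s)" and \<tau>: "\<And>s. (\<tau> has_real_derivative \<beta> s) (at s)"
    and smooth: "smooth \<alpha>" "smooth \<beta>" and nz: "\<And>s. \<alpha> s \<noteq> 0" and bij: "bij \<sigma>"

lemma
  assumes "straightening \<sigma>\<^sub>1 \<tau>\<^sub>1 \<alpha>\<^sub>1 \<beta>\<^sub>1" and "straightening \<sigma>\<^sub>2 \<tau>\<^sub>2 \<alpha>\<^sub>2 \<beta>\<^sub>2"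
  shows smooth_aligning_map: "smooth (aligning_map \<sigma>\<^sub>1 \<tau>\<^sub>1 \<sigma>\<^sub>2 \<tau>\<^sub>2 k)"
    and frechet_derivative_aligning_map:
      "frechet_derivative (aligning_map \<sigma>\<^sub>1 \<tau>\<^sub>1 \<sigma>\<^sub>2 \<tau>\<^sub>2 k) (at p) u =
       (let s = fst p; s' = inv \<sigma>\<^sub>2 (\<sigma>\<^sub>1 s) in
         (\<alpha>\<^sub>1 s / \<alpha>\<^sub>2 s' * fst u, k * snd u + (k * \<beta>\<^sub>1 s - \<beta>\<^sub>2 s' * (\<alpha>\<^sub>1 s / \<alpha>\<^sub>2 s')) * fst u))"
proof -
  interpret A: straightening \<sigma>\<^sub>1 \<tau>\<^sub>1 \<alpha>\<^sub>1 \<beta>\<^sub>1 by fact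
  interpret B: straightening \<sigma>\<^sub>2 \<tau>\<^sub>2 \<alpha>\<^sub>2 \<beta>\<^sub>2 by fact
  note change = change_of_height[OF A.\<sigma> B.\<sigma> A.smooth(1) B.smooth(1) B.nz B.bij]
  define f where "f s = inv \<sigma>\<^sub>2 (\<sigma>\<^sub>1 s)" for s
  define h where "h s = k * \<tau>\<^sub>1 s - \<tau>\<^sub>2 (f s)" for s
  have f: "(f has_real_derivative \<alpha>\<^sub>1 s / \<alpha>\<^sub>2 (f s)) (at s)" "smooth f" for s
    using change by (simp_all add: f_def[abs_def])
  have h: "(h has_real_derivative k * \<beta>\<^sub>1 s - \<beta>\<^sub>2 (f s) * (\<alpha>\<^sub>1 s / \<alpha>\<^sub>2 (f s))) (at s)" for s
    unfolding h_def[abs_def]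
    by (intro DERIV_diff DERIV_cmult A.\<tau> DERIV_chain2[where f = \<tau>\<^sub>2 and g = f, OF B.\<tau> f(1)])
  have "smooth \<tau>\<^sub>1" "smooth \<tau>\<^sub>2"
    using smooth_antiderivative[OF A.\<tau> A.smooth(2)] smooth_antiderivative[OF B.\<tau> B.smooth(2)] .
  then have "smooth (\<lambda>s. k * \<tau>\<^sub>1 s + (- 1) * \<tau>\<^sub>2 (f s))"
    by (intro smooth_add smooth_mult smooth_const smooth_compose_real[OF _ f(2)])
  then have "smooth h"
    by (simp add: h_def[abs_def])
  moreover have F: "aligning_map \<sigma>\<^sub>1 \<tau>\<^sub>1 \<sigma>\<^sub>2 \<tau>\<^sub>2 k = (\<lambda>p. (f (fst p), k * snd p + h (fst p)))"
    by (simp add: aligning_map_def f_def h_def)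
  ultimately show "smooth (aligning_map \<sigma>\<^sub>1 \<tau>\<^sub>1 \<sigma>\<^sub>2 \<tau>\<^sub>2 k)"
    using smooth_fibre_preserving[OF f(2)] by simp
  show "frechet_derivative (aligning_map \<sigma>\<^sub>1 \<tau>\<^sub>1 \<sigma>\<^sub>2 \<tau>\<^sub>2 k) (at p) u =
       (let s = fst p; s' = inv \<sigma>\<^sub>2 (\<sigma>\<^sub>1 s) in
         (\<alpha>\<^sub>1 s / \<alpha>\<^sub>2 s' * fst u, k * snd u + (k * \<beta>\<^sub>1 s - \<beta>\<^sub>2 s' * (\<alpha>\<^sub>1 s / \<alpha>\<^sub>2 s')) * fst u))"
    unfolding F frechet_derivative_fibre_preserving[OF f(1) h] by (simp add: Let_def f_def)
qed

definition warped_metric ::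
  "(real \<Rightarrow> real) \<Rightarrow> (real \<Rightarrow> real) \<Rightarrow> (real \<Rightarrow> real) \<Rightarrow> (real \<Rightarrow> real) \<Rightarrow>
   real \<times> real \<Rightarrow> real \<times> real \<Rightarrow> real \<times> real \<Rightarrow> real" where
  "warped_metric \<rho> \<sigma> \<alpha> \<beta> p u v = (\<alpha> (fst p))\<^sup>2 * fst u * fst v +
     \<rho> (\<sigma> (fst p)) * (snd u + \<beta> (fst p) * fst u) * (snd v + \<beta> (fst p) * fst v)"

text \<open>The factor \<open>k^2\<close> between the warping functions is absorbed by stretching the second straight
  coordinate by \<open>k\<close>.\<close>
lemma isometric_warped_metrics:
  assumes 1: "straightening \<sigma>\<^sub>1 \<tau>\<^sub>1 \<alpha>\<^sub>1 \<beta>\<^sub>1" and 2: "straightening \<sigma>\<^sub>2 \<tau>\<^sub>2 \<alpha>\<^sub>2 \<beta>\<^sub>2"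
    and "k \<noteq> 0" and \<rho>: "\<And>r. \<rho>\<^sub>1 r = k\<^sup>2 * \<rho>\<^sub>2 r"
  shows "isometric (warped_metric \<rho>\<^sub>1 \<sigma>\<^sub>1 \<alpha>\<^sub>1 \<beta>\<^sub>1) (warped_metric \<rho>\<^sub>2 \<sigma>\<^sub>2 \<alpha>\<^sub>2 \<beta>\<^sub>2)"
proof -
  interpret A: straightening \<sigma>\<^sub>1 \<tau>\<^sub>1 \<alpha>\<^sub>1 \<beta>\<^sub>1 by fact
  interpret B: straightening \<sigma>\<^sub>2 \<tau>\<^sub>2 \<alpha>\<^sub>2 \<beta>\<^sub>2 by fact
  define F where "F = aligning_map \<sigma>\<^sub>1 \<tau>\<^sub>1 \<sigma>\<^sub>2 \<tau>\<^sub>2 k"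
  define F' where "F' = aligning_map \<sigma>\<^sub>2 \<tau>\<^sub>2 \<sigma>\<^sub>1 \<tau>\<^sub>1 (1 / k)"
  have F'F: "F' (F p) = p" and FF': "F (F' p) = p" for p
    using aligning_map_inverse[OF A.bij B.bij \<open>k \<noteq> 0\<close>]
      aligning_map_inverse[OF B.bij A.bij, of "1 / k"] \<open>k \<noteq> 0\<close>
    by (simp_all add: F_def F'_def)
  then have "bij F"
    by (intro o_bij[of F']) auto
  have "inv F = F'"
    using F'F FF' by (intro inv_equality)
  have "warped_metric \<rho>\<^sub>2 \<sigma>\<^sub>2 \<alpha>\<^sub>2 \<beta>\<^sub>2 (F p) (frechet_derivative F (at p) u) (frechet_derivative F (at p) v) =
      warped_metric \<rho>\<^sub>1 \<sigma>\<^sub>1 \<alpha>\<^sub>1 \<beta>\<^sub>1 p u v" for p u v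
  proof -
    define s s' where "s = fst p" "s' = inv \<sigma>\<^sub>2 (\<sigma>\<^sub>1 s)"
    have \<sigma>s': "\<sigma>\<^sub>2 s' = \<sigma>\<^sub>1 s"
      using B.bij by (simp add: s_s'_def bij_is_surj surj_f_inv_f)
    have [simp]: "fst (F p) = s'"
      by (simp add: F_def aligning_map_def s_s'_def)
    have dF: "frechet_derivative F (at p) u =
        (\<alpha>\<^sub>1 s / \<alpha>\<^sub>2 s' * fst u, k * snd u + (k * \<beta>\<^sub>1 s - \<beta>\<^sub>2 s' * (\<alpha>\<^sub>1 s / \<alpha>\<^sub>2 s')) * fst u)" for u
      using frechet_derivative_aligning_map[OF 1 2] by (simp add: F_def s_s'_def Let_def)
    have "snd (frechet_derivative F (at p) u) + \<beta>\<^sub>2 s' * fst (frechet_derivative F (at p) u) =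
        k * (snd u + \<beta>\<^sub>1 s * fst u)" for u
      by (simp add: dF algebra_simps)
    moreover have "(\<alpha>\<^sub>2 s')\<^sup>2 * fst (frechet_derivative F (at p) u) * fst (frechet_derivative F (at p) v) =
        (\<alpha>\<^sub>1 s)\<^sup>2 * fst u * fst v"
      using B.nz[of s'] by (simp add: dF power2_eq_square)
    ultimately show ?thesis
      by (simp add: warped_metric_def \<sigma>s' \<rho> power2_eq_square flip: s_s'_def)
  qed
  then show ?thesis
    unfolding isometric_def
    using \<open>bij F\<close> \<open>inv F = F'\<close> smooth_aligning_map[OF 1 2] smooth_aligning_map[OF 2 1]
    by (intro exI[of _ F]) (simp add: F_def F'_def)
qed

section \<open>Twizzlers\<close>

locale twizzler_profile = twisted_profile +
  fixes M :: real
  assumes w_pos: "w > 0" and M_bound: "M > - 1/4"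
    and mean_curvature_1: "\<And>p. mean_curvature \<phi> p = 1"
    and level: "\<And>s. twizzler_h w (\<xi>\<^sub>1 x z s) (\<xi>\<^sub>2 x z s) = M"
begin

text \<open>The zeros of \<open>\<xi>\<^sub>1\<close> on the level curve lie at \<open>\<xi>\<^sub>2 = (- 1 \<plusminus> sqrt (1 + 4 M)) / 2\<close>, and these two formulas are
  the values of \<open>G = 1 + w^2 (\<xi>\<^sub>1^2 + \<xi>\<^sub>2^2)\<close> there.\<close>
definition G_min :: real where
  "G_min = 1 + w\<^sup>2 * ((1 - sqrt (1 + 4 * M)) / 2)\<^sup>2"

definition G_max :: real where
  "G_max = 1 + w\<^sup>2 * ((1 + sqrt (1 + 4 * M)) / 2)\<^sup>2"

text \<open>In terms of \<open>u\<close> the first integral \<open>h_w(\<xi>\<^sub>1, \<xi>\<^sub>2) = M\<close> makes \<open>G\<close> an affine function, while \<open>D^2\<close> and the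
  Gauss curvature become rational functions; square roots disappear from the computation.\<close>
definition u :: "real \<Rightarrow> real" where
  "u s = \<xi>\<^sub>2 x z s / D s"

lemma G_extrema:
  "G_max + G_min = 2 + w\<^sup>2 * (1 + 2 * M)" "G_max - G_min = w\<^sup>2 * sqrt (1 + 4 * M)"
  "G_min * G_max = w\<^sup>2 + (1 + w\<^sup>2 * M)\<^sup>2" "0 < G_min" "G_min < G_max"
proof -
  define y where "y = sqrt (1 + 4 * M)"
  have y: "y > 0" "M = (y\<^sup>2 - 1) / 4"
    using M_bound by (simp_all add: y_def)
  show sum: "G_max + G_min = 2 + w\<^sup>2 * (1 + 2 * M)"
    and diff: "G_max - G_min = w\<^sup>2 * sqrt (1 + 4 * M)"
    unfolding G_min_def G_max_def y_def[symmetric] by (simp_all add: y(2) field_simps power2_eq_square)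
  show "G_min * G_max = w\<^sup>2 + (1 + w\<^sup>2 * M)\<^sup>2"
    unfolding G_min_def G_max_def y_def[symmetric] by (simp add: y(2) field_simps power2_eq_square)
  show "0 < G_min"
    by (simp add: G_min_def add_pos_nonneg)
  have "w\<^sup>2 * y > 0"
    using w_pos y(1) by simp
  then show "G_min < G_max"
    using diff unfolding y_def by linarith
qed

lemma \<xi>\<^sub>2_eq: "\<xi>\<^sub>2 x z s = u s * D s"
  using D_pos[of s] by (simp add: u_def)

lemma G_eq_u: "G s = 1 + w\<^sup>2 * (M - u s)" and G_eq_D_u: "G s = (D s)\<^sup>2 * (1 + w\<^sup>2 * (u s)\<^sup>2)"
proof -
  have "(x s)\<^sup>2 + (z s)\<^sup>2 = M - u s"
    using level[of s] by (simp add: twizzler_h_def u_def D_def \<xi>_norm)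
  then show "G s = 1 + w\<^sup>2 * (M - u s)"
    by (simp add: G_def)
  show "G s = (D s)\<^sup>2 * (1 + w\<^sup>2 * (u s)\<^sup>2)"
    by (simp add: G_eq \<xi>\<^sub>2_eq power2_eq_square algebra_simps)
qed

text \<open>The left-hand side is \<open>\<xi>\<^sub>1' G\<close>. Mean curvature \<open>1\<close> enters the computation only here: it expresses \<open>\<kappa>\<close> by
  \<open>D\<close> and \<open>\<xi>\<^sub>2\<close>.\<close>
lemma \<xi>\<^sub>1'_eq: "(1 + \<kappa> s * \<xi>\<^sub>2 x z s) * G s = (D s)\<^sup>2 * (1 + 2 * (D s)\<^sup>2 * u s)"
proof -
  have "\<kappa> s * G s + w\<^sup>2 * \<xi>\<^sub>2 x z s = 2 * D s ^ 3"
    using curvatures(1)[of "(s, 0)"] D_pos[of s] mean_curvature_1 by (simp add: field_simps)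
  then have \<kappa>: "\<kappa> s * G s = 2 * D s ^ 3 - w\<^sup>2 * \<xi>\<^sub>2 x z s"
    by simp
  have "(1 + \<kappa> s * \<xi>\<^sub>2 x z s) * G s = G s + \<xi>\<^sub>2 x z s * (\<kappa> s * G s)"
    by (simp add: algebra_simps)
  then show ?thesis
    unfolding \<kappa> by (simp add: G_eq \<xi>\<^sub>2_eq algebra_simps power2_eq_square power3_eq_cube)
qed

text \<open>Eliminating \<open>\<kappa>\<close> by the mean curvature equation and \<open>D\<close> by \<open>G = D^2 (1 + w^2 u^2)\<close> leaves a function of
  \<open>u\<close>, that is of \<open>G\<close>, and this function is increasing.\<close>
lemma gauss_curvature_eq: "gauss_curvature \<phi> p = 1 - G_min * G_max / (G (fst p))\<^sup>2"
proof -
  define s where "s = fst p"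
  \<comment> \<open>Both sides are polynomials in \<open>u s\<close>, as \<open>G s\<close> is affine in it.\<close>
  have *: "(G s)\<^sup>2 - G_min * G_max = - w\<^sup>2 * (1 + w\<^sup>2 * (u s)\<^sup>2 + 2 * u s * G s)"
    unfolding G_extrema(3) G_eq_u by (simp add: algebra_simps power2_eq_square)
  have "((G s)\<^sup>2 - G_min * G_max) * (D s)\<^sup>2 = - w\<^sup>2 * (1 + 2 * (D s)\<^sup>2 * u s) * G s"
    unfolding * using G_eq_D_u[of s] by (simp add: algebra_simps)
  then have "((G s)\<^sup>2 - G_min * G_max) * (D s)\<^sup>2 * (D s)\<^sup>2 =
      - w\<^sup>2 * ((1 + \<kappa> s * \<xi>\<^sub>2 x z s) * G s) * G s"
    unfolding \<xi>\<^sub>1'_eq by simp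
  then have "((G s)\<^sup>2 - G_min * G_max) * D s ^ 4 = - w\<^sup>2 * (1 + \<kappa> s * \<xi>\<^sub>2 x z s) * (G s)\<^sup>2"
    by (simp add: power2_eq_square power4_eq_xxxx mult.assoc)
  then have "- w\<^sup>2 * (1 + \<kappa> s * \<xi>\<^sub>2 x z s) / D s ^ 4 = ((G s)\<^sup>2 - G_min * G_max) / (G s)\<^sup>2"
    using D_pos[of s] G_pos[of s] by (subst frac_eq_eq) (simp_all only: zero_less_power less_imp_neq[symmetric] simp_thms)
  also have "\<dots> = 1 - G_min * G_max / (G s)\<^sup>2"
    using G_pos[of s] by (simp add: diff_divide_distrib)
  finally show ?thesis
    using curvatures(2)[of p] by (simp add: s_def)
qed

definition G_mean :: real where
  "G_mean = (G_max + G_min) / 2"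

text \<open>This is half the derivative of \<open>G\<close> with respect to the height \<open>\<sigma>\<close>, where \<open>\<sigma>' = D / sqrt G\<close>. Together with
  \<open>G - G_mean\<close> it forms a harmonic oscillator in \<open>\<sigma>\<close>.\<close>
definition quadrature :: "real \<Rightarrow> real" where
  "quadrature s = w\<^sup>2 * \<xi>\<^sub>1 x z s * sqrt (G s) / D s"

text \<open>Conservation of energy, obtained from the first integral without differentiation.\<close>
lemma phase_circle: "(G s - G_mean)\<^sup>2 + (quadrature s)\<^sup>2 = ((G_max - G_min) / 2)\<^sup>2"
proof -
  have "(quadrature s)\<^sup>2 * (D s)\<^sup>2 = w\<^sup>2 * (w\<^sup>2 * (\<xi>\<^sub>1 x z s)\<^sup>2) * G s"
    using D_pos[of s] G_pos[of s]
    by (simp add: quadrature_def power_divide power_mult_distrib)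
  also have "\<dots> = w\<^sup>2 * ((D s)\<^sup>2 - 1) * G s"
    by (simp add: D_square)
  also have "\<dots> = w\<^sup>2 * (G s - (1 + w\<^sup>2 * (u s)\<^sup>2)) * (D s)\<^sup>2"
    using G_eq_D_u[of s] by (simp add: algebra_simps)
  finally have Q: "(quadrature s)\<^sup>2 = w\<^sup>2 * (G s - (1 + w\<^sup>2 * (u s)\<^sup>2))"
    using D_pos[of s] by simp
  have m: "G_mean = 1 + w\<^sup>2 * (1 + 2 * M) / 2"
    unfolding G_mean_def G_extrema(1) by simp
  have "((G_max - G_min) / 2)\<^sup>2 = w\<^sup>2 * w\<^sup>2 * (1 + 4 * M) / 4"
    unfolding G_extrema(2) using M_bound by (simp add: power_mult_distrib power_divide power2_eq_square)
  then show ?thesis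
    unfolding Q m G_eq_u by (simp add: field_simps power2_eq_square)
qed

text \<open>Differentiating the conserved energy gives the second equation only where \<open>\<xi>\<^sub>1 \<noteq> 0\<close>; it is
  therefore computed from the equation for \<open>\<xi>\<^sub>1'\<close>.\<close>
lemma phase_derivatives:
  "((\<lambda>s. G s - G_mean) has_real_derivative 2 * quadrature s * (D s / sqrt (G s))) (at s)"
  "(quadrature has_real_derivative - 2 * (G s - G_mean) * (D s / sqrt (G s))) (at s)"
proof -
  define r where "r s = sqrt (G s)" for s
  define e where "e = 1 + \<kappa> s * \<xi>\<^sub>2 x z s"
  have r: "r s > 0" "(r s)\<^sup>2 = G s"
    using G_pos[of s] by (simp_all add: r_def)
  have "((\<lambda>s. G s - G_mean) has_real_derivative 2 * w\<^sup>2 * \<xi>\<^sub>1 x z s - 0) (at s)"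
    by (intro DERIV_diff G_deriv DERIV_const)
  moreover have "2 * w\<^sup>2 * \<xi>\<^sub>1 x z s - 0 = 2 * quadrature s * (D s / sqrt (G s))"
    using r(1) D_pos[of s] by (simp add: quadrature_def flip: r_def)
  ultimately show "((\<lambda>s. G s - G_mean) has_real_derivative 2 * quadrature s * (D s / sqrt (G s))) (at s)"
    by (simp only:)
  have half: "inverse a / 2 * (2 * w\<^sup>2 * b) = w\<^sup>2 * b / a" for a b :: real
    by (simp add: field_simps)
  have dr: "(r has_real_derivative w\<^sup>2 * \<xi>\<^sub>1 x z s / r s) (at s)"
    unfolding r_def[abs_def]
    by (rule DERIV_cong[OF DERIV_chain2[where f = sqrt and g = G, OF DERIV_real_sqrt[OF G_pos] G_deriv]])
      (rule half)
  have d\<xi>: "(\<xi>\<^sub>1 x z has_real_derivative e) (at s)"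
    unfolding e_def by (rule \<xi>\<^sub>1_deriv)
  have dD: "(D has_real_derivative w\<^sup>2 * \<xi>\<^sub>1 x z s * e / D s) (at s)"
    unfolding e_def by (rule D_deriv)
  have dQ: "((\<lambda>s. w\<^sup>2 * (\<xi>\<^sub>1 x z s * r s / D s)) has_real_derivative
      w\<^sup>2 * (((e * r s + (w\<^sup>2 * \<xi>\<^sub>1 x z s / r s) * \<xi>\<^sub>1 x z s) * D s -
        \<xi>\<^sub>1 x z s * r s * (w\<^sup>2 * \<xi>\<^sub>1 x z s * e / D s)) / (D s * D s))) (at s)"
    using D_pos[of s] by (intro DERIV_cmult DERIV_divide DERIV_mult d\<xi> dr dD) simp
  have Q: "quadrature = (\<lambda>s. w\<^sup>2 * (\<xi>\<^sub>1 x z s * r s / D s))"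
    by (simp add: quadrature_def[abs_def] r_def mult.assoc)
  have \<xi>\<^sub>1_sq: "w\<^sup>2 * (\<xi>\<^sub>1 x z s)\<^sup>2 = (D s)\<^sup>2 - 1"
    by (simp add: D_square)
  have e: "e * (r s)\<^sup>2 = (D s)\<^sup>2 * (1 + 2 * (D s)\<^sup>2 * u s)"
    using \<xi>\<^sub>1'_eq[of s] by (simp add: e_def r(2))
  have m: "- 2 * (G s - G_mean) = w\<^sup>2 * (1 + 2 * u s)"
    unfolding G_mean_def G_extrema(1) G_eq_u by (simp add: field_simps)
  have "((e * r s + (w\<^sup>2 * \<xi>\<^sub>1 x z s / r s) * \<xi>\<^sub>1 x z s) * D s -
        \<xi>\<^sub>1 x z s * r s * (w\<^sup>2 * \<xi>\<^sub>1 x z s * e / D s)) * (r s * D s) =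
      (e * (r s)\<^sup>2 + w\<^sup>2 * (\<xi>\<^sub>1 x z s)\<^sup>2) * (D s)\<^sup>2 - (e * (r s)\<^sup>2) * (w\<^sup>2 * (\<xi>\<^sub>1 x z s)\<^sup>2)"
    using r(1) D_pos[of s] by (simp add: field_simps power2_eq_square)
  also have "\<dots> = (1 + 2 * u s) * (D s * D s) * (D s * D s)"
    unfolding \<xi>\<^sub>1_sq e by (simp add: algebra_simps power2_eq_square)
  finally have "((e * r s + (w\<^sup>2 * \<xi>\<^sub>1 x z s / r s) * \<xi>\<^sub>1 x z s) * D s -
        \<xi>\<^sub>1 x z s * r s * (w\<^sup>2 * \<xi>\<^sub>1 x z s * e / D s)) / (D s * D s) = (1 + 2 * u s) * (D s / r s)"
    using r(1) D_pos[of s] by (simp add: nonzero_divide_eq_eq nonzero_eq_divide_eq mult.assoc)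
  then show "(quadrature has_real_derivative - 2 * (G s - G_mean) * (D s / sqrt (G s))) (at s)"
    using dQ unfolding m Q r_def[symmetric] by (simp only: mult.assoc)
qed

lemma smooth_profile_quantities:
  "smooth G" "smooth D" "smooth (\<xi>\<^sub>2 x z)"
proof -
  have pos: "0 < 1 + w * w * (a * a)" for a
    by (simp add: add_pos_nonneg)
  have "smooth (\<lambda>s. 1 + w * w * (x s * x s + z s * z s))"
    by (intro smooth_add smooth_mult smooth_const smooth_profile)
  then show "smooth G"
    by (simp add: G_def[abs_def] power2_eq_square)
  have "smooth (\<lambda>s. sqrt (1 + w * w * ((x s * deriv x s + z s * deriv z s) *
      (x s * deriv x s + z s * deriv z s))))"
    by (intro smooth_sqrt pos smooth_add smooth_mult smooth_const smooth_profile smooth_tangent)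
  then show "smooth D"
    by (simp add: D_def[abs_def] \<xi>\<^sub>1_def power2_eq_square)
  have "smooth (\<lambda>s. (- 1) * x s * deriv z s + z s * deriv x s)"
    by (intro smooth_add smooth_mult smooth_const smooth_profile smooth_tangent)
  then show "smooth (\<xi>\<^sub>2 x z)"
    by (simp add: \<xi>\<^sub>2_def[abs_def])
qed

lemma smooth_coordinate_rates:
  "smooth (\<lambda>s. D s / sqrt (G s))" "smooth (\<lambda>s. w * \<xi>\<^sub>2 x z s / G s)"
proof -
  show "smooth (\<lambda>s. D s / sqrt (G s))"
    by (intro smooth_divide smooth_sqrt smooth_profile_quantities G_pos)
      (use G_pos in \<open>simp add: less_imp_neq[symmetric]\<close>)
  show "smooth (\<lambda>s. w * \<xi>\<^sub>2 x z s / G s)"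
    by (intro smooth_divide smooth_mult smooth_const smooth_profile_quantities)
      (use G_pos in \<open>simp add: less_imp_neq[symmetric]\<close>)
qed

definition G_of_height :: "real \<Rightarrow> real" where
  "G_of_height r = G_mean + (G_max - G_min) / 2 * cos (2 * r)"

text \<open>The height has a derivative bounded below by \<open>1 / sqrt G_max\<close> since \<open>D \<ge> 1\<close>, so it runs through the
  whole real line; its additive constant is chosen such that the phase vanishes.\<close>
lemma straightening_exists:
  obtains \<sigma> \<tau> where "straightening \<sigma> \<tau> (\<lambda>s. D s / sqrt (G s)) (\<lambda>s. w * \<xi>\<^sub>2 x z s / G s)"
    and "\<And>s. G s = G_of_height (\<sigma> s)"
proof -
  let ?\<alpha> = "\<lambda>s. D s / sqrt (G s)" and ?\<beta> = "\<lambda>s. w * \<xi>\<^sub>2 x z s / G s"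
  have cont: "continuous_on UNIV f" if "smooth f" for f :: "real \<Rightarrow> real"
    using that[unfolded smooth_def, rule_format, of 0] by simp
  from antiderivative_exists[OF cont[OF smooth_coordinate_rates(1)]]
  obtain \<sigma>\<^sub>0 where \<sigma>\<^sub>0: "\<forall>s. (\<sigma>\<^sub>0 has_real_derivative ?\<alpha> s) (at s)"
    by (rule exE)
  note \<sigma>\<^sub>0 = \<sigma>\<^sub>0[rule_format]
  from antiderivative_exists[OF cont[OF smooth_coordinate_rates(2)]]
  obtain \<tau> where \<tau>: "\<forall>s. (\<tau> has_real_derivative ?\<beta> s) (at s)"
    by (rule exE)
  note \<tau> = \<tau>[rule_format]
  have amplitude: "(G_max - G_min) / 2 > 0"
    using G_extrema(5) by simp
  from phase_of_rotating_pair[OF phase_derivatives(1) phase_derivatives(2) \<sigma>\<^sub>0 phase_circle amplitude]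
  obtain \<delta> where "\<forall>s. G s - G_mean = (G_max - G_min) / 2 * cos (2 * (\<sigma>\<^sub>0 s + \<delta>))"
    by (rule exE)
  note \<delta> = this[rule_format]
  define \<sigma> where "\<sigma> s = \<sigma>\<^sub>0 s + \<delta>" for s
  have \<sigma>: "(\<sigma> has_real_derivative ?\<alpha> s) (at s)" for s
    unfolding \<sigma>_def[abs_def] using DERIV_add[OF \<sigma>\<^sub>0 DERIV_const] by simp
  have G: "G s = G_of_height (\<sigma> s)" for s
    using \<delta>[of s] by (simp add: G_of_height_def \<sigma>_def)
  have pos: "?\<alpha> s > 0" for s
    using D_pos G_pos by simp
  have below: "1 / sqrt G_max \<le> ?\<alpha> s" for s
  proof (intro frac_le D_ge_1)
    have "(G s - G_mean)\<^sup>2 \<le> ((G_max - G_min) / 2)\<^sup>2"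
      using phase_circle[of s] zero_le_power2[of "quadrature s"] by linarith
    then have "G s - G_mean \<le> (G_max - G_min) / 2"
      using amplitude by (rule power2_le_imp_le[OF _ less_imp_le])
    then show "sqrt (G s) \<le> sqrt G_max"
      by (simp add: G_mean_def field_simps)
    show "0 < sqrt (G s)" "0 \<le> D s"
      using G_pos D_pos[of s] by simp_all
  qed
  have "1 / sqrt G_max > 0"
    using G_extrema(4,5) by simp
  then have "bij \<sigma>"
    by (rule bij_if_derivative_bounded_below[OF \<sigma> below])
  moreover have "?\<alpha> s \<noteq> 0" for s
    using pos[of s] by (rule less_imp_neq[symmetric])
  ultimately have "straightening \<sigma> \<tau> ?\<alpha> ?\<beta>"
    by (intro straightening.intro \<sigma> \<tau> smooth_coordinate_rates)
  then show ?thesis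
    using that G by blast
qed

text \<open>Completing the square in \<open>dt\<close>: \<open>ds^2 + 2 F ds dt + G dt^2 = (D^2 / G) ds^2 + G (dt + (F / G) ds)^2\<close> with
  \<open>F = w \<xi>\<^sub>2\<close> and \<open>D^2 = G - F^2\<close>.\<close>
lemma induced_metric_warped:
  assumes "\<And>s. G s = \<rho> (\<sigma> s)"
  shows "induced_metric \<phi> = warped_metric \<rho> \<sigma> (\<lambda>s. D s / sqrt (G s)) (\<lambda>s. w * \<xi>\<^sub>2 x z s / G s)"
proof (intro ext)
  fix p v v' :: "real \<times> real"
  define s where "s = fst p"
  have "(D s)\<^sup>2 + (w * \<xi>\<^sub>2 x z s)\<^sup>2 = G s"
    by (simp add: G_eq power_mult_distrib)
  then have D: "(D s)\<^sup>2 = G s - (w * \<xi>\<^sub>2 x z s)\<^sup>2"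
    by simp
  have "warped_metric \<rho> \<sigma> (\<lambda>s. D s / sqrt (G s)) (\<lambda>s. w * \<xi>\<^sub>2 x z s / G s) p v v' =
      (D s)\<^sup>2 / G s * fst v * fst v' +
      G s * (snd v + w * \<xi>\<^sub>2 x z s / G s * fst v) * (snd v' + w * \<xi>\<^sub>2 x z s / G s * fst v')"
    using G_pos[of s] by (simp add: warped_metric_def power_divide flip: s_def assms)
  also have "\<dots> = bilinear_form 1 (w * \<xi>\<^sub>2 x z s) (G s) v v'"
    unfolding D bilinear_form_def using G_pos[of s] by (simp add: field_simps power2_eq_square)
  finally show "induced_metric \<phi> p v v' =
      warped_metric \<rho> \<sigma> (\<lambda>s. D s / sqrt (G s)) (\<lambda>s. w * \<xi>\<^sub>2 x z s / G s) p v v'"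
    by (simp add: induced_metric_\<phi> s_def)
qed

text \<open>Every value of the cosine is taken because the height is onto.\<close>
lemma G_range:
  "G_min \<le> G s" "G s \<le> G_max" "G_min \<in> range G" "G_max \<in> range G"
proof -
  obtain \<sigma> \<tau> where "straightening \<sigma> \<tau> (\<lambda>s. D s / sqrt (G s)) (\<lambda>s. w * \<xi>\<^sub>2 x z s / G s)"
    and G: "\<And>s. G s = G_of_height (\<sigma> s)"
    using straightening_exists by blast
  then have surj: "surj \<sigma>"
    using straightening.bij bij_is_surj by blast
  have a: "0 \<le> (G_max - G_min) / 2"
    using G_extrema(5) by simp
  have "(G_max - G_min) / 2 * cos (2 * \<sigma> s) \<le> (G_max - G_min) / 2"
    "- ((G_max - G_min) / 2) \<le> (G_max - G_min) / 2 * cos (2 * \<sigma> s)"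
    using mult_left_mono[OF cos_le_one[of "2 * \<sigma> s"] a] mult_left_mono[OF cos_ge_minus_one[of "2 * \<sigma> s"] a]
    by simp_all
  then show "G_min \<le> G s" "G s \<le> G_max"
    unfolding G G_of_height_def G_mean_def by (simp_all add: field_simps)
  obtain s\<^sub>0 s\<^sub>1 where "\<sigma> s\<^sub>0 = 0" "\<sigma> s\<^sub>1 = pi / 2"
    using surj by (metis surjD)
  then have "G s\<^sub>0 = G_max" "G s\<^sub>1 = G_min"
    unfolding G G_of_height_def G_mean_def by (simp_all add: field_simps)
  then show "G_min \<in> range G" "G_max \<in> range G"
    by (metis rangeI)+
qed

lemma gauss_curvature_extrema:
  obtains p q where "\<And>r. gauss_curvature \<phi> r \<le> gauss_curvature \<phi> p"
    and "\<And>r. gauss_curvature \<phi> q \<le> gauss_curvature \<phi> r"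
    and "gauss_curvature \<phi> q \<noteq> 0"
    and "gauss_curvature \<phi> p / gauss_curvature \<phi> q = - (G_min / G_max)"
proof -
  obtain s\<^sub>0 s\<^sub>1 where s: "G s\<^sub>0 = G_max" "G s\<^sub>1 = G_min"
    using G_range(3,4) by (metis imageE)
  have le: "1 - G_min * G_max / a\<^sup>2 \<le> 1 - G_min * G_max / b\<^sup>2" if "0 < a" "a \<le> b" for a b
    using that G_extrema(4,5) by (simp add: frac_le power_mono)
  have max: "gauss_curvature \<phi> (s\<^sub>0, 0) = (G_max - G_min) / G_max"
    and min: "gauss_curvature \<phi> (s\<^sub>1, 0) = - ((G_max - G_min) / G_min)"
    unfolding gauss_curvature_eq using s G_extrema(4,5) by (simp_all add: field_simps power2_eq_square)
  show ?thesis
  proof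
    show "gauss_curvature \<phi> r \<le> gauss_curvature \<phi> (s\<^sub>0, 0)" for r
      unfolding gauss_curvature_eq using le[of "G (fst r)" G_max] G_pos G_range(2) by (simp add: s)
    show "gauss_curvature \<phi> (s\<^sub>1, 0) \<le> gauss_curvature \<phi> r" for r
      unfolding gauss_curvature_eq using le[of G_min "G (fst r)"] G_extrema(4) G_range(1) by (simp add: s)
    show "gauss_curvature \<phi> (s\<^sub>1, 0) \<noteq> 0"
      unfolding min using G_extrema(4,5) by simp
    show "gauss_curvature \<phi> (s\<^sub>0, 0) / gauss_curvature \<phi> (s\<^sub>1, 0) = - (G_min / G_max)"
      unfolding max min using G_extrema(4,5) by simp
  qed
qed

lemma twice_G_extrema:
  "2 * G_min = 2 + (1 + 2 * M - sqrt (1 + 4 * M)) * w\<^sup>2"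
  "2 * G_max = 2 + (1 + 2 * M + sqrt (1 + 4 * M)) * w\<^sup>2"
  using G_extrema(1,2) by (simp_all add: algebra_simps)

lemma G_extrema_ratio:
  "G_min / G_max = (2 + (1 + 2 * M - sqrt (1 + 4 * M)) * w\<^sup>2) / (2 + (1 + 2 * M + sqrt (1 + 4 * M)) * w\<^sup>2)"
  unfolding twice_G_extrema[symmetric] by simp

end

text \<open>With \<open>G_min = c G_max\<close> the warping function is \<open>G_max / 2\<close> times \<open>1 + c + (1 - c) cos (2 \<sigma>)\<close>, so that
  two of them with the same \<open>c\<close> are proportional.\<close>
lemma isometric_if_same_ratio:
  assumes 1: "twizzler_profile w\<^sub>1 x\<^sub>1 z\<^sub>1 M\<^sub>1" and 2: "twizzler_profile w\<^sub>2 x\<^sub>2 z\<^sub>2 M\<^sub>2"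
    and r1: "twizzler_profile.G_min w\<^sub>1 M\<^sub>1 = c * twizzler_profile.G_max w\<^sub>1 M\<^sub>1"
    and r2: "twizzler_profile.G_min w\<^sub>2 M\<^sub>2 = c * twizzler_profile.G_max w\<^sub>2 M\<^sub>2"
  shows "isometric (induced_metric (twizzler_map w\<^sub>1 x\<^sub>1 z\<^sub>1)) (induced_metric (twizzler_map w\<^sub>2 x\<^sub>2 z\<^sub>2))"
proof -
  interpret A: twizzler_profile w\<^sub>1 x\<^sub>1 z\<^sub>1 M\<^sub>1 by fact
  interpret B: twizzler_profile w\<^sub>2 x\<^sub>2 z\<^sub>2 M\<^sub>2 by fact
  obtain \<sigma>\<^sub>1 \<tau>\<^sub>1 where A: "straightening \<sigma>\<^sub>1 \<tau>\<^sub>1 (\<lambda>s. A.D s / sqrt (A.G s)) (\<lambda>s. w\<^sub>1 * \<xi>\<^sub>2 x\<^sub>1 z\<^sub>1 s / A.G s)"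
      "\<And>s. A.G s = A.G_of_height (\<sigma>\<^sub>1 s)"
    using A.straightening_exists by blast
  obtain \<sigma>\<^sub>2 \<tau>\<^sub>2 where B: "straightening \<sigma>\<^sub>2 \<tau>\<^sub>2 (\<lambda>s. B.D s / sqrt (B.G s)) (\<lambda>s. w\<^sub>2 * \<xi>\<^sub>2 x\<^sub>2 z\<^sub>2 s / B.G s)"
      "\<And>s. B.G s = B.G_of_height (\<sigma>\<^sub>2 s)"
    using B.straightening_exists by blast
  define k where "k = sqrt (A.G_max / B.G_max)"
  have pos: "A.G_max > 0" "B.G_max > 0"
    using A.G_extrema(4,5) B.G_extrema(4,5) by simp_all
  then have k: "k \<noteq> 0" "A.G_max = k\<^sup>2 * B.G_max"
    by (simp_all add: k_def)
  have "A.G_of_height r = k\<^sup>2 * B.G_of_height r" for r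
    unfolding A.G_of_height_def B.G_of_height_def A.G_mean_def B.G_mean_def r1 r2 k(2)
    by (simp add: field_simps)
  from isometric_warped_metrics[OF A(1) B(1) k(1) this]
  show ?thesis
    unfolding A.induced_metric_warped[of A.G_of_height, OF A(2)]
      B.induced_metric_warped[of B.G_of_height, OF B(2)] .
qed

text \<open>The profile curve is the slice \<open>t = 0\<close> of the immersion and inherits its smoothness.\<close>
lemma twizzler_profile_if_twizzler:
  assumes "twizzler w x z 1" and "w > 0" and "M > - 1/4"
    and "\<And>s. twizzler_h w (\<xi>\<^sub>1 x z s) (\<xi>\<^sub>2 x z s) = M"
  shows "twizzler_profile w x z M"
proof -
  let ?\<phi> = "twizzler_map w x z"
  have "smooth ?\<phi>"
    using assms(1) by (simp add: twizzler_def immersion_def)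
  then have component: "smooth (\<lambda>s. ?\<phi> (s, 0) $ i)" for i
    unfolding smooth_def
    by (intro allI C_k_compose_bounded_linear[where A = "\<lambda>s. (s, 0)" and L = "\<lambda>v. v $ i"] bounded_linear_vec_nth
        bounded_linear_Pair bounded_linear_ident bounded_linear_zero) auto
  have "smooth x" "smooth z"
    using component[of 1] component[of 3] by (simp_all add: twizzler_map_def)
  then show ?thesis
    using assms by unfold_locales (auto simp: twizzler_def arc_length_parametrized_def)
qed

lemma Twizzlers_profile:
  assumes "\<phi> \<in> \<TT> M v" and "w = sqrt ((1 - v) / v)" and "w > 0" and "M > - 1/4"
  obtains x z where "\<phi> = twizzler_map w x z" and "twizzler_profile w x z M"
  using assms twizzler_profile_if_twizzler[of w _ _ M] unfolding Twizzlers_def by auto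

text \<open>The third conclusion says \<open>G_min = c G_max\<close>; solved for \<open>v\<close> it is the formula defining \<open>v\<close>. The bounds
  on \<open>M\<close> are those for which \<open>w^2\<close> comes out positive: with \<open>a = sqrt c\<close> they say that \<open>y\<close> lies between
  \<open>(1 - a) / (1 + a)\<close> and its reciprocal, the roots of \<open>(1 - c) (1 + y^2) = 2 (1 + c) y\<close>.\<close>
lemma isometric_family_parameter:
  fixes c M :: real
  defines "y \<equiv> sqrt (1 + 4 * M)"
  defines "v \<equiv> (y - 1 - 2 * M + c * (y + 1 + 2 * M)) / (y + 1 - 2 * M + c * (y - 1 + 2 * M))"
  defines "w \<equiv> sqrt ((1 - v) / v)"
  assumes c: "0 < c" "c < 1" and M: "- sqrt c / (1 + sqrt c)\<^sup>2 < M" "M < sqrt c / (1 - sqrt c)\<^sup>2"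
  shows "M > - 1/4" "w > 0" "2 + (1 + 2 * M - y) * w\<^sup>2 = c * (2 + (1 + 2 * M + y) * w\<^sup>2)"
proof -
  define a where "a = sqrt c"
  have a: "0 < a" "a < 1" "c = a\<^sup>2"
    using c by (simp_all add: a_def)
  have lo: "((1 - a) / (1 + a))\<^sup>2 = 1 + 4 * (- a / (1 + a)\<^sup>2)"
    and hi: "((1 + a) / (1 - a))\<^sup>2 = 1 + 4 * (a / (1 - a)\<^sup>2)"
  proof -
    have sq: "(1 - a)\<^sup>2 = (1 + a)\<^sup>2 - 4 * a"
      by (simp add: algebra_simps power2_eq_square)
    have nz: "(1 + a)\<^sup>2 \<noteq> 0" "(1 - a)\<^sup>2 \<noteq> 0"
      using a by simp_all
    have "((1 + a)\<^sup>2 - 4 * a) / (1 + a)\<^sup>2 = 1 + 4 * (- a / (1 + a)\<^sup>2)"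
      using nz(1) by (simp add: diff_divide_distrib)
    then show "((1 - a) / (1 + a))\<^sup>2 = 1 + 4 * (- a / (1 + a)\<^sup>2)"
      by (simp only: power_divide sq)
    have "((1 - a)\<^sup>2 + 4 * a) / (1 - a)\<^sup>2 = 1 + 4 * (a / (1 - a)\<^sup>2)"
      using nz(2) by (simp add: add_divide_distrib)
    then show "((1 + a) / (1 - a))\<^sup>2 = 1 + 4 * (a / (1 - a)\<^sup>2)"
      by (simp add: power_divide sq)
  qed
  have lt: "((1 - a) / (1 + a))\<^sup>2 < 1 + 4 * M" "1 + 4 * M < ((1 + a) / (1 - a))\<^sup>2"
    unfolding lo hi using M by (simp_all flip: a_def)
  have "0 \<le> ((1 - a) / (1 + a))\<^sup>2"
    by simp
  then show "M > - 1/4"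
    using lt(1) by linarith
  then have y2: "y\<^sup>2 = 1 + 4 * M"
    by (simp add: y_def)
  have "(1 - a) / (1 + a) < y" "y < (1 + a) / (1 - a)"
    using lt a unfolding y_def by (simp_all add: real_less_rsqrt real_less_lsqrt)
  \<comment> \<open>The numerator of \<open>v\<close> is half of this product of two positive factors.\<close>
  then have "0 < ((1 + a) * y - (1 - a)) * ((1 + a) - (1 - a) * y)"
    using a by (intro mult_pos_pos) (simp_all add: field_simps)
  also have "\<dots> = 2 * (1 + c) * y - (1 - c) * (1 + y\<^sup>2)"
    unfolding a(3) by (simp add: algebra_simps power2_eq_square)
  finally have N: "0 < y - 1 - 2 * M + c * (y + 1 + 2 * M)" (is "0 < ?N")
    unfolding y2 by (simp add: algebra_simps)
  have quotient: "(1 - n / (n + d)) / (n / (n + d)) = d / n" if "n > 0" "d > 0" for n d :: real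
  proof -
    have "1 - n / (n + d) = d / (n + d)"
      using that by (simp add: field_simps)
    then show ?thesis
      using that by simp
  qed
  have "?N + 2 * (1 - c) = y + 1 - 2 * M + c * (y - 1 + 2 * M)"
    by (simp add: algebra_simps)
  then have v: "v = ?N / (?N + 2 * (1 - c))"
    by (simp only: v_def)
  have quot: "(1 - v) / v = 2 * (1 - c) / ?N"
    unfolding v by (rule quotient[OF N]) (simp add: c)
  then have "(1 - v) / v > 0"
    using N c by simp
  then show "w > 0"
    by (simp add: w_def)
  have "w\<^sup>2 = 2 * (1 - c) / ?N"
    using \<open>(1 - v) / v > 0\<close> quot by (simp add: w_def)
  then have "w\<^sup>2 * ?N = 2 * (1 - c)"
    using N by simp
  then show "2 + (1 + 2 * M - y) * w\<^sup>2 = c * (2 + (1 + 2 * M + y) * w\<^sup>2)"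
    by (simp add: algebra_simps)
qed

theorem theorem1p12:
  shows "(\<forall>M w v :: real. M > - 1/4 \<longrightarrow> w > 0 \<longrightarrow> v = 1 / (1 + w\<^sup>2) \<longrightarrow>
            (\<forall>\<phi> \<in> \<TT> M v. \<exists>p q.
               (\<forall>r. gauss_curvature \<phi> r \<le> gauss_curvature \<phi> p) \<and>
               (\<forall>r. gauss_curvature \<phi> q \<le> gauss_curvature \<phi> r) \<and>
               gauss_curvature \<phi> q \<noteq> 0 \<and>
               gauss_curvature \<phi> p / gauss_curvature \<phi> q =
                 - ((2 + (1 + 2 * M - sqrt (1 + 4 * M)) * w\<^sup>2) /
                    (2 + (1 + 2 * M + sqrt (1 + 4 * M)) * w\<^sup>2))))
       \<and> (\<forall>c :: real. 0 < c \<longrightarrow> c < 1 \<longrightarrow>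
            (let S = (\<Union>M \<in> {- sqrt c / (1 + sqrt c)\<^sup>2 <..< sqrt c / (1 - sqrt c)\<^sup>2}.
                 \<TT> M ((sqrt (1 + 4 * M) - 1 - 2 * M + c * (sqrt (1 + 4 * M) + 1 + 2 * M)) /
                      (sqrt (1 + 4 * M) + 1 - 2 * M + c * (sqrt (1 + 4 * M) - 1 + 2 * M))))
             in \<forall>\<phi> \<in> S. \<forall>\<psi> \<in> S. isometric (induced_metric \<phi>) (induced_metric \<psi>)))"
proof (intro conjI allI impI ballI, goal_cases)
  case (1 M w v \<phi>)
  have "1 + w\<^sup>2 > 0"
    by (simp add: add_pos_nonneg)
  then have "(1 - v) / v = w\<^sup>2"
    unfolding 1(3) by (simp add: field_simps)
  then have w: "sqrt ((1 - v) / v) = w"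
    using \<open>w > 0\<close> by simp
  obtain x z where \<phi>: "\<phi> = twizzler_map w x z" and "twizzler_profile w x z M"
    by (rule Twizzlers_profile[OF 1(4) w[symmetric] \<open>w > 0\<close> \<open>M > - 1/4\<close>])
  then interpret twizzler_profile w x z M by simp
  show ?case
    unfolding \<phi> by (rule gauss_curvature_extrema) (unfold G_extrema_ratio, blast)
next
  case (2 c)
  show ?case
    unfolding Let_def
  proof (intro ballI, goal_cases)
    case (1 \<phi> \<psi>)
    have profile: "\<exists>w x z M. \<phi> = twizzler_map w x z \<and> twizzler_profile w x z M \<and>
        twizzler_profile.G_min w M = c * twizzler_profile.G_max w M"
      if \<phi>: "\<phi> \<in> (\<Union>M \<in> {- sqrt c / (1 + sqrt c)\<^sup>2 <..< sqrt c / (1 - sqrt c)\<^sup>2}.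
                 \<TT> M ((sqrt (1 + 4 * M) - 1 - 2 * M + c * (sqrt (1 + 4 * M) + 1 + 2 * M)) /
                      (sqrt (1 + 4 * M) + 1 - 2 * M + c * (sqrt (1 + 4 * M) - 1 + 2 * M))))" for \<phi>
    proof -
      from \<phi> obtain M where M: "- sqrt c / (1 + sqrt c)\<^sup>2 < M" "M < sqrt c / (1 - sqrt c)\<^sup>2"
        and mem: "\<phi> \<in> \<TT> M ((sqrt (1 + 4 * M) - 1 - 2 * M + c * (sqrt (1 + 4 * M) + 1 + 2 * M)) /
                      (sqrt (1 + 4 * M) + 1 - 2 * M + c * (sqrt (1 + 4 * M) - 1 + 2 * M)))"
        (is "_ \<in> \<TT> M ?v")
        by auto
      define w where "w = sqrt ((1 - ?v) / ?v)"
      note parameter = isometric_family_parameter[OF 2 M, folded w_def]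
      obtain x z where \<phi>_eq: "\<phi> = twizzler_map w x z" and profile: "twizzler_profile w x z M"
        by (rule Twizzlers_profile[OF mem w_def parameter(2,1)])
      interpret twizzler_profile w x z M by (rule profile)
      have "2 * G_min = c * (2 * G_max)"
        unfolding twice_G_extrema by (rule parameter(3))
      then have "G_min = c * G_max"
        by simp
      with \<phi>_eq profile show ?thesis
        by blast
    qed
    obtain w\<^sub>1 x\<^sub>1 z\<^sub>1 M\<^sub>1 w\<^sub>2 x\<^sub>2 z\<^sub>2 M\<^sub>2
      where "\<phi> = twizzler_map w\<^sub>1 x\<^sub>1 z\<^sub>1" "twizzler_profile w\<^sub>1 x\<^sub>1 z\<^sub>1 M\<^sub>1"
          "twizzler_profile.G_min w\<^sub>1 M\<^sub>1 = c * twizzler_profile.G_max w\<^sub>1 M\<^sub>1"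
        and "\<psi> = twizzler_map w\<^sub>2 x\<^sub>2 z\<^sub>2" "twizzler_profile w\<^sub>2 x\<^sub>2 z\<^sub>2 M\<^sub>2"
          "twizzler_profile.G_min w\<^sub>2 M\<^sub>2 = c * twizzler_profile.G_max w\<^sub>2 M\<^sub>2"
      using profile[OF 1(1)] profile[OF 1(2)] by auto
    then show ?case
      by (simp only: isometric_if_same_ratio)
  qed
qed

end
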